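(* Let $[x_k]=(x_0,\dots,x_N)$ be a Gaussian sequence of $\mathbb{R}^d$-valued vectors with covariance function $C_{l_1,l_2}=\mathrm{Cov}(x_{l_1},x_{l_2})$, and consider the equation $$C_{k,i}=\begin{bmatrix} C_{k,j} & C_{k,l}\end{bmatrix}\begin{bmatrix} C_j & C_{j,l}\\ C_{l,j} & C_l\end{bmatrix}^{+}\begin{bmatrix} C_{j,i}\\ C_{l,i}\end{bmatrix},\qquad (\ast)$$ where the superscript $+$ denotes the Moore–Penrose inverse. Then $[x_k]$ is reciprocal if and only if $(\ast)$ holds (a) for all $i,j,k,l\in[0,N]$ with $l<i<j<k$, and (b) for all $i,j,k\in[0,N-1]$ with $i<j<k<l=N$. Equivalently, $[x_k]$ is reciprocal if and only if $(\ast)$ holds (a) for all $i,j,k,l\in[0,N]$ with $i<j<k<l$, and (b) for all $i,j,k\in[1,N]$ with $0=l<i<j<k$.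
   Context: Sequences are indexed by discrete time $[0,N]=(0,1,\dots,N)$; $[x_k]_i^j=(x_i,\dots,x_j)$; $C_i=C_{i,i}$. A Gaussian sequence is jointly Gaussian, with possibly singular covariance. $[x_k]$ is reciprocal iff conditioned on the states at any two times $j<l$, the segment inside $(j,l)$ is independent of the two segments outside $[j,l]$; equivalently, $F(\xi_k|[x_i]_0^j,[x_i]_l^N)=F(\xi_k|x_j,x_l)$ (a.s.) for all $j<k<l$ in $[0,N]$ and all $\xi_k\in\mathbb{R}^d$, where $F(\cdot|\cdot)$ is the conditional CDF. *)

theory Defs
  imports "HOL-Probability.Probability"
begin

section \<open>The Moore--Penrose inverse\<close>

definition is_moore_penrose :: "real^'n^'m \<Rightarrow> real^'m^'n \<Rightarrow> bool" where
  "is_moore_penrose A X \<longleftrightarrow>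
     A ** X ** A = A \<and> X ** A ** X = X \<and>
     transpose (A ** X) = A ** X \<and> transpose (X ** A) = X ** A"

definition moore_penrose :: "real^'n^'m \<Rightarrow> real^'m^'n" where
  "moore_penrose A = (THE X. is_moore_penrose A X)"

lemma is_moore_penrose_unique:
  assumes X: "is_moore_penrose A X" and Y: "is_moore_penrose A Y"
  shows "X = Y"
proof -
  note d = is_moore_penrose_def
  have "A ** X = transpose (A ** X)" using X by (simp add: d)
  also have "\<dots> = transpose ((A ** Y) ** (A ** X))"
    using Y by (metis d matrix_mul_assoc)
  also have "\<dots> = (A ** X) ** (A ** Y)"
    using X Y by (simp add: d matrix_transpose_mul)
  also have "\<dots> = A ** Y"
    using X by (metis d matrix_mul_assoc)
  finally have 1: "A ** X = A ** Y" .
  have "X ** A = transpose (X ** A)" using X by (simp add: d)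
  also have "\<dots> = transpose ((X ** A) ** (Y ** A))"
    using Y by (metis d matrix_mul_assoc)
  also have "\<dots> = (Y ** A) ** (X ** A)"
    using X Y by (simp add: d matrix_transpose_mul)
  also have "\<dots> = Y ** A"
    using X by (metis d matrix_mul_assoc)
  finally have 2: "X ** A = Y ** A" .
  have "X = X ** (A ** X)" using X by (metis d matrix_mul_assoc)
  also have "\<dots> = (X ** A) ** Y" by (simp add: 1 matrix_mul_assoc)
  also have "\<dots> = Y" using Y by (simp add: 2 d)
  finally show ?thesis .
qed

lemma matrix_inner_inverse_exists:
  fixes A :: "real^'n^'m"
  shows "\<exists>G :: real^'m^'n. A ** G ** A = A"
proof -
  obtain g where g: "linear g" "\<And>v. v \<in> range ((*v) A) \<Longrightarrow> A *v g v = v"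
    using real_vector.linear_exists_right_inverse_on[of "(*v) A" UNIV]
    by (auto simp: matrix_vector_mul_linear)
  have "(A ** matrix g ** A) *v x = A *v x" for x
    using g by (simp add: matrix_vector_mul_assoc[symmetric] matrix_works)
  then show ?thesis by (metis matrix_eq)
qed

lemma orthogonal_projector_exists:
  fixes A :: "real^'n^'m"
  shows "\<exists>G :: real^'n^'n. A ** G ** transpose A ** A = A \<and>
           transpose (A ** G ** transpose A) = A ** G ** transpose A"
proof -
  obtain G where G: "(transpose A ** A) ** G ** (transpose A ** A) = transpose A ** A"
    using matrix_inner_inverse_exists by blast
  define P where "P = A ** G ** transpose A"
  have PA: "P ** A = A"
  proof -
    have N: "transpose A ** (P ** A) = transpose A ** A"
      using G by (simp add: P_def matrix_mul_assoc)
    have "(P ** A) *v x = A *v x" for x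
    proof -
      define u where "u = (P ** A) *v x - A *v x"
      have "transpose A *v u = 0"
        using N by (simp add: u_def matrix_vector_mult_diff_distrib matrix_vector_mul_assoc)
      then have "u \<bullet> (A *v y) = 0" for y
        by (metis dot_lmul_matrix inner_zero_left vector_transpose_matrix transpose_transpose
            transpose_matrix_vector)
      moreover have "u = A *v (G *v (transpose A *v (A *v x)) - x)"
        by (simp add: u_def P_def matrix_vector_mult_diff_distrib matrix_vector_mul_assoc
            matrix_mul_assoc)
      ultimately have "u \<bullet> u = 0" by metis
      then show ?thesis by (simp add: u_def)
    qed
    then show ?thesis by (metis matrix_eq)
  qed
  then have "transpose A ** transpose P = transpose A"
    by (metis matrix_transpose_mul)
  then have "P ** transpose P = P"
    by (metis P_def matrix_mul_assoc)
  then have "transpose P = P"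
    by (metis matrix_transpose_mul transpose_transpose)
  with PA show ?thesis unfolding P_def by blast
qed

lemma is_moore_penrose_exists:
  fixes A :: "real^'n^'m"
  shows "\<exists>X. is_moore_penrose A X"
proof -
  obtain G where G: "A ** G ** A = A" using matrix_inner_inverse_exists by blast
  obtain H where H: "A ** H ** transpose A ** A = A"
    "transpose (A ** H ** transpose A) = A ** H ** transpose A"
    using orthogonal_projector_exists by blast
  obtain K where K: "transpose A ** K ** A ** transpose A = transpose A"
    "transpose (transpose A ** K ** A) = transpose A ** K ** A"
    using orthogonal_projector_exists[of "transpose A"] by auto
  define P Q where "P = A ** H ** transpose A" and "Q = transpose A ** K ** A"
  have P: "P ** A = A" "transpose P = P" using H by (auto simp: P_def)
  have Q: "A ** Q = A" "transpose Q = Q"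
    using K by (auto simp: Q_def) (metis K(2) matrix_transpose_mul transpose_transpose)
  define X where "X = Q ** G ** P"
  have AX: "A ** X = P"
    by (metis X_def P_def Q(1) G matrix_mul_assoc)
  have XA: "X ** A = Q"
    by (metis X_def Q_def P(1) G matrix_mul_assoc)
  have "Q ** Q = Q"
    by (metis Q_def Q(1) matrix_mul_assoc)
  then have "Q ** X = X" by (simp add: X_def matrix_mul_assoc)
  then have "is_moore_penrose A X"
    using P Q AX XA by (simp add: is_moore_penrose_def)
  then show ?thesis ..
qed

lemma is_moore_penrose_moore_penrose: "is_moore_penrose A (moore_penrose A)"
  unfolding moore_penrose_def
  by (rule theI') (use is_moore_penrose_exists is_moore_penrose_unique in blast)

section \<open>Block matrices\<close>

definition block_row :: "real^'n^'m \<Rightarrow> real^'k^'m \<Rightarrow> real^('n + 'k)^'m" where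
  "block_row A B = (\<chi> r c. case c of Inl c' \<Rightarrow> A $ r $ c' | Inr c' \<Rightarrow> B $ r $ c')"

definition block_col :: "real^'n^'m \<Rightarrow> real^'n^'k \<Rightarrow> real^'n^('m + 'k)" where
  "block_col A B = (\<chi> r c. case r of Inl r' \<Rightarrow> A $ r' $ c | Inr r' \<Rightarrow> B $ r' $ c)"

section \<open>Gaussian sequences\<close>

text \<open>Point masses are admitted, as normal laws of variance zero.\<close>

definition gaussian_rv :: "'a measure \<Rightarrow> ('a \<Rightarrow> real) \<Rightarrow> bool" where
  "gaussian_rv M X \<longleftrightarrow>
     X \<in> borel_measurable M \<and>
     ((\<exists>\<mu> \<sigma>. 0 < \<sigma> \<and> distributed M lborel X (normal_density \<mu> \<sigma>)) \<or>
      (\<exists>\<mu>. AE \<omega> in M. X \<omega> = \<mu>))"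

text \<open>
  Joint Gaussianity of \<open>(x\<^sub>0, \<dots>, x\<^sub>N)\<close>: every linear functional of the stacked vector
  is (possibly degenerate) normal.
\<close>

definition gaussian_sequence :: "'a measure \<Rightarrow> nat \<Rightarrow> (nat \<Rightarrow> 'a \<Rightarrow> real^'d) \<Rightarrow> bool" where
  "gaussian_sequence M N x \<longleftrightarrow>
     (\<forall>k\<le>N. x k \<in> borel_measurable M) \<and>
     (\<forall>a :: nat \<Rightarrow> real^'d. gaussian_rv M (\<lambda>\<omega>. \<Sum>k\<le>N. a k \<bullet> x k \<omega>))"

definition covariance :: "'a measure \<Rightarrow> ('a \<Rightarrow> real) \<Rightarrow> ('a \<Rightarrow> real) \<Rightarrow> real" where
  "covariance M X Y =
     (\<integral>\<omega>. (X \<omega> - (\<integral>\<omega>'. X \<omega>' \<partial>M)) * (Y \<omega> - (\<integral>\<omega>'. Y \<omega>' \<partial>M)) \<partial>M)"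

definition cov :: "'a measure \<Rightarrow> (nat \<Rightarrow> 'a \<Rightarrow> real^'d) \<Rightarrow> nat \<Rightarrow> nat \<Rightarrow> real^'d^'d" where
  "cov M x l1 l2 = (\<chi> a b. covariance M (\<lambda>\<omega>. x l1 \<omega> $ a) (\<lambda>\<omega>. x l2 \<omega> $ b))"

section \<open>Reciprocal sequences\<close>

definition generated :: "'a measure \<Rightarrow> (nat \<Rightarrow> 'a \<Rightarrow> real^'d) \<Rightarrow> nat set \<Rightarrow> 'a measure" where
  "generated M x K = sigma (space M) (\<Union>k\<in>K. {x k -` B \<inter> space M | B. B \<in> sets borel})"

definition cond_indep :: "'a measure \<Rightarrow> 'a measure \<Rightarrow> 'a measure \<Rightarrow> 'a measure \<Rightarrow> bool" where
  "cond_indep M G F1 F2 \<longleftrightarrow>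
     (\<forall>A\<in>sets F1. \<forall>B\<in>sets F2. AE \<omega> in M.
        real_cond_exp M G (indicator (A \<inter> B)) \<omega> =
        real_cond_exp M G (indicator A) \<omega> * real_cond_exp M G (indicator B) \<omega>)"

definition reciprocal :: "'a measure \<Rightarrow> nat \<Rightarrow> (nat \<Rightarrow> 'a \<Rightarrow> real^'d) \<Rightarrow> bool" where
  "reciprocal M N x \<longleftrightarrow>
     (\<forall>j l. j < l \<and> l \<le> N \<longrightarrow>
        cond_indep M (generated M x {j, l})
          (generated M x {j<..<l}) (generated M x ({..<j} \<union> {l<..N})))"

section \<open>The covariance equation\<close>

definition cov_eq :: "(nat \<Rightarrow> nat \<Rightarrow> real^'d^'d) \<Rightarrow> nat \<Rightarrow> nat \<Rightarrow> nat \<Rightarrow> nat \<Rightarrow> bool" where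
  "cov_eq C i j k l \<longleftrightarrow>
     C k i =
       block_row (C k j) (C k l)
       ** moore_penrose (block_col (block_row (C j j) (C j l)) (block_row (C l j) (C l l)))
       ** block_col (C j i) (C l i)"

end

theory Submission
  imports Defs
begin

text \<open>
  For a Gaussian family the residual of \<open>x\<^sub>k\<close> after linear regression on \<open>(x\<^sub>j, x\<^sub>l)\<close> is independent of
  everything it is uncorrelated with, so conditional independence given \<open>(x\<^sub>j, x\<^sub>l)\<close> amounts to
  residuals being uncorrelated, and the Moore--Penrose formula computes the cross-covariance of the
  residual with \<open>x\<^sub>i\<close>. The independence part rests on one principle: an integrable \<open>V\<close> with
  \<open>E[cos (\<Sum> a\<^sub>k \<bullet> x\<^sub>k + c) V] = 0\<close> for all \<open>a\<close> and \<open>c\<close> satisfies \<open>E[V | x] = 0\<close>, which follows from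
  the one-dimensional uniqueness theorem for characteristic functions, one coordinate at a time.

  What remains is that conditions (a) and (b), which omit one of the two outside segments except
  when \<open>l\<close> is an end of the interval, give the full family of equations. This is the contraction
  property of conditional independence: if \<open>x\<^sub>i\<close> is orthogonal to \<open>x\<^sub>k\<close> and \<open>x\<^sub>l\<close> given \<open>(x\<^sub>j, x\<^sub>n)\<close>,
  and \<open>x\<^sub>n\<close> to \<open>x\<^sub>k\<close> given \<open>(x\<^sub>j, x\<^sub>l)\<close>, then \<open>x\<^sub>i\<close> is orthogonal to \<open>x\<^sub>k\<close> given \<open>(x\<^sub>j, x\<^sub>l)\<close>.
\<close>

section \<open>Integrals tested against cosines\<close>

lemma integrable_mult_bounded:
  fixes f V :: "'a \<Rightarrow> real"
  assumes "integrable M V" "f \<in> borel_measurable M" "\<And>\<omega>. \<bar>f \<omega>\<bar> \<le> B"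
  shows "integrable M (\<lambda>\<omega>. f \<omega> * V \<omega>)"
proof (rule Bochner_Integration.integrable_bound)
  show "integrable M (\<lambda>\<omega>. B * V \<omega>)" using assms(1) by simp
  show "(\<lambda>\<omega>. f \<omega> * V \<omega>) \<in> borel_measurable M" using assms by measurable
  have "0 \<le> B" using assms(3)[of undefined] by linarith
  then show "AE \<omega> in M. norm (f \<omega> * V \<omega>) \<le> norm (B * V \<omega>)"
    using assms(3) by (intro always_eventually) (auto simp: abs_mult intro!: mult_right_mono)
qed

text \<open>The positive and negative parts of \<open>V\<close> have the same integral, so after
  division by this common mass each is the density of a probability measure. The hypothesis
  \<open>orth\<close> says that \<open>X\<close> has the same characteristic function under both,
  and Levy uniqueness makes its two laws coincide.\<close>

lemma integral_indicator_vimage_eq_0: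
  fixes X V :: "'a \<Rightarrow> real"
  assumes X [measurable]: "X \<in> borel_measurable M" and V: "integrable M V"
    and orth: "\<And>t c. (\<integral>\<omega>. cos (t * X \<omega> + c) * V \<omega> \<partial>M) = 0"
    and B [measurable]: "B \<in> sets borel"
  shows "(\<integral>\<omega>. indicator B (X \<omega>) * V \<omega> \<partial>M) = 0"
proof -
  have [measurable]: "V \<in> borel_measurable M" using V by simp
  define p q where "p = (\<lambda>\<omega>. max 0 (V \<omega>))" and "q = (\<lambda>\<omega>. max 0 (- V \<omega>))"
  have pq: "p \<omega> \<ge> 0" "q \<omega> \<ge> 0" "V \<omega> = p \<omega> - q \<omega>" for \<omega>
    by (auto simp: p_def q_def)
  have int: "integrable M p" "integrable M q"
    using V by (auto simp: p_def q_def intro!: integrable_max)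
  then have [measurable]: "p \<in> borel_measurable M" "q \<in> borel_measurable M" by auto
  define m where "m = (\<integral>\<omega>. p \<omega> \<partial>M)"
  \<comment> \<open>Frequency and phase zero test \<open>V\<close> against the constant 1, so both
    parts have mass \<open>m\<close>.\<close>
  have "(\<integral>\<omega>. V \<omega> \<partial>M) = 0" using orth[of 0 0] by simp
  then have mq: "m = (\<integral>\<omega>. q \<omega> \<partial>M)"
    using int by (simp add: m_def pq(3))
  show ?thesis
  \<comment> \<open>Mass zero cannot be normalized, but then \<open>V\<close> vanishes almost
    everywhere.\<close>
  proof (cases "m = 0")
    case True
    then have "AE \<omega> in M. p \<omega> = 0" "AE \<omega> in M. q \<omega> = 0"
      using integral_nonneg_eq_0_iff_AE[OF int(1)] integral_nonneg_eq_0_iff_AE[OF int(2)] pq mq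
      by (auto simp: m_def)
    then have "AE \<omega> in M. indicator B (X \<omega>) * V \<omega> = 0"
      by eventually_elim (simp add: pq(3))
    then show ?thesis by (rule integral_eq_zero_AE)
  next
    case False
    then have m: "m > 0"
      using integral_nonneg_AE[where f = p and M = M] pq by (simp add: m_def order_less_le)
    define D where "D r = distr (density M (\<lambda>\<omega>. ennreal (r \<omega> / m))) borel X" for r
    have rd: "real_distribution (D r)"
      if r: "integrable M r" "\<And>\<omega>. r \<omega> \<ge> 0" "m = (\<integral>\<omega>. r \<omega> \<partial>M)" for r
    proof -
      have [measurable]: "r \<in> borel_measurable M" using r by simp
      have "(\<integral>\<^sup>+\<omega>. ennreal (r \<omega> / m) \<partial>M) = ennreal (\<integral>\<omega>. r \<omega> / m \<partial>M)"
        using r m by (intro nn_integral_eq_integral) auto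
      also have "\<dots> = 1" using r(3) m by simp
      finally have "prob_space (density M (\<lambda>\<omega>. ennreal (r \<omega> / m)))"
        by (intro prob_spaceI) (simp add: emeasure_density)
      then show ?thesis unfolding D_def
        by (intro prob_space.real_distribution_distr) auto
    qed
    have ch: "char (D r) t = (CLINT \<omega>|M. (r \<omega> / m) *\<^sub>R iexp (t * X \<omega>))"
      if r: "integrable M r" "\<And>\<omega>. r \<omega> \<ge> 0" for r t
      unfolding char_def D_def using r m
      by (subst integral_distr; (subst integral_density)?) auto
    have ci: "integrable M (\<lambda>\<omega>. (r \<omega> / m) *\<^sub>R iexp (t * X \<omega>))"
      if r: "integrable M r" for r and t :: real
    proof (rule Bochner_Integration.integrable_bound)
      show "integrable M (\<lambda>\<omega>. r \<omega> / m)" using r by simp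
    qed (use r in \<open>auto simp: norm_mult\<close>)
    have "char (D p) = char (D q)"
    proof
      fix t
      have "char (D p) t - char (D q) t
          = (CLINT \<omega>|M. (p \<omega> / m) *\<^sub>R iexp (t * X \<omega>) - (q \<omega> / m) *\<^sub>R iexp (t * X \<omega>))"
        using ci int pq by (simp add: ch)
      also have "\<dots> = (CLINT \<omega>|M. (V \<omega> / m) *\<^sub>R iexp (t * X \<omega>))" (is "_ = ?I")
        by (intro Bochner_Integration.integral_cong)
           (auto simp: pq(3) diff_divide_distrib scaleR_diff_left)
      also have "?I = 0"
      proof (rule complex_eqI)
        have "Re ?I = (\<integral>\<omega>. Re ((V \<omega> / m) *\<^sub>R iexp (t * X \<omega>)) \<partial>M)"
          by (rule integral_Re[OF ci[OF V], symmetric])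
        also have "\<dots> = (\<integral>\<omega>. (cos (t * X \<omega> + 0) * V \<omega>) / m \<partial>M)"
          by (intro Bochner_Integration.integral_cong) (auto simp: Re_exp)
        also have "\<dots> = 0" using orth[of t 0] by (simp only: integral_divide_zero)
        finally show "Re ?I = Re 0" by simp
        have "Im ?I = (\<integral>\<omega>. Im ((V \<omega> / m) *\<^sub>R iexp (t * X \<omega>)) \<partial>M)"
          by (rule integral_Im[OF ci[OF V], symmetric])
        \<comment> \<open>The phase \<open>- pi / 2\<close> turns the cosine into the sine; this is
          what the free phase \<open>c\<close> in \<open>orth\<close> provides.\<close>
        also have "\<dots> = (\<integral>\<omega>. (cos (t * X \<omega> + (- pi / 2)) * V \<omega>) / m \<partial>M)"
          by (intro Bochner_Integration.integral_cong) (auto simp: Im_exp cos_diff)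
        also have "\<dots> = 0" using orth[of t "- pi / 2"] by (simp only: integral_divide_zero)
        finally show "Im ?I = Im 0" by simp
      qed
      finally show "char (D p) t = char (D q) t" by simp
    qed
    then have eq: "D p = D q"
      using rd[OF int(1)] rd[OF int(2)] pq m_def mq by (intro Levy_uniqueness) auto
    have me: "(\<integral>y. indicator B y \<partial>D r) = (\<integral>\<omega>. indicator B (X \<omega>) * r \<omega> \<partial>M) / m"
      if r: "integrable M r" "\<And>\<omega>. r \<omega> \<ge> 0" for r
    proof -
      have "(\<integral>y. indicator B y \<partial>D r) = (\<integral>\<omega>. (r \<omega> / m) *\<^sub>R indicator B (X \<omega>) \<partial>M :: real)"
        unfolding D_def using r m
        by (subst integral_distr; (subst integral_density)?) auto
      also have "\<dots> = (\<integral>\<omega>. (indicator B (X \<omega>) * r \<omega>) / m \<partial>M)"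
        by (intro Bochner_Integration.integral_cong) auto
      finally show ?thesis by simp
    qed
    have "(\<integral>\<omega>. indicator B (X \<omega>) * p \<omega> \<partial>M) = (\<integral>\<omega>. indicator B (X \<omega>) * q \<omega> \<partial>M)"
      using me[OF int(1)] me[OF int(2)] pq m eq by simp
    moreover have "integrable M (\<lambda>\<omega>. indicator B (X \<omega>) * r \<omega>)" if "integrable M r" for r :: "'a \<Rightarrow> real"
      using that by (rule integrable_mult_bounded[where B = 1]) (auto simp: indicator_def)
    ultimately show ?thesis
      using int by (simp add: pq(3) right_diff_distrib)
  qed
qed

text \<open>Induction on \<open>S\<close>: the indicator of one coordinate is absorbed into
  \<open>V\<close>, which is therefore kept arbitrary. The new weight still annihilates cosines in
  the remaining coordinates, by the one-dimensional case applied to \<open>y s\<close> with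
  \<open>V\<close> multiplied by such a cosine.\<close>

lemma integral_indicator_rectangle_eq_0:
  fixes y :: "'i \<Rightarrow> 'a \<Rightarrow> real" and V :: "'a \<Rightarrow> real"
  assumes "finite S" and "\<And>m. m \<in> S \<Longrightarrow> y m \<in> borel_measurable M" and "integrable M V"
    and "\<And>t c. (\<integral>\<omega>. cos ((\<Sum>m\<in>S. t m * y m \<omega>) + c) * V \<omega> \<partial>M) = 0"
    and "\<And>m. m \<in> S \<Longrightarrow> B m \<in> sets borel"
  shows "(\<integral>\<omega>. indicator {\<omega>. \<forall>m\<in>S. y m \<omega> \<in> B m} \<omega> * V \<omega> \<partial>M) = 0"
  using assms
proof (induction S arbitrary: V rule: finite_induct)
  case empty
  then show ?case using empty(3)[of _ 0] by simp
next
  case (insert s S)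
  have meas [measurable]: "y s \<in> borel_measurable M" "\<And>m. m \<in> S \<Longrightarrow> y m \<in> borel_measurable M" "B s \<in> sets borel"
    using insert by auto
  have [measurable]: "(\<lambda>\<omega>. \<Sum>m\<in>S. t m * y m \<omega>) \<in> borel_measurable M" for t
    using meas by (intro borel_measurable_sum borel_measurable_times) auto
  define V' where "V' \<omega> = indicator (B s) (y s \<omega>) * V \<omega>" for \<omega>
  have V': "integrable M V'" unfolding V'_def
    by (rule integrable_mult_bounded[where B = 1]) (use insert in \<open>auto simp: indicator_def\<close>)
  have "(\<integral>\<omega>. cos ((\<Sum>m\<in>S. t m * y m \<omega>) + c) * V' \<omega> \<partial>M) = 0" for t c
  proof -
    have "(\<integral>\<omega>. cos (\<tau> * y s \<omega> + d) * (cos ((\<Sum>m\<in>S. t m * y m \<omega>) + c) * V \<omega>) \<partial>M) = 0" for \<tau> d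
    proof -
      have i: "integrable M (\<lambda>\<omega>. cos ((\<Sum>m\<in>insert s S. t m * y m \<omega>) + c) * V \<omega>)" for t c
        by (rule integrable_mult_bounded[where B = 1]) (use insert in auto)
      \<comment> \<open>Product to sum: the two resulting cosines carry frequency \<tau> at
        \<open>s\<close>, and \<open>t\<close> respectively \<open>- t\<close> on
        \<open>S\<close>.\<close>
      define t1 t2 where "t1 = t(s := \<tau>)" and "t2 = (\<lambda>m. - t m)(s := \<tau>)"
      have ts: "t1 s = \<tau>" "t2 s = \<tau>" by (auto simp: t1_def t2_def)
      have s: "(\<Sum>m\<in>S. t1 m * y m \<omega>) = (\<Sum>m\<in>S. t m * y m \<omega>)"
        "(\<Sum>m\<in>S. t2 m * y m \<omega>) = - (\<Sum>m\<in>S. t m * y m \<omega>)" for \<omega>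
        using insert.hyps by (auto simp: t1_def t2_def sum_negf[symmetric] intro!: sum.cong)
      have "(\<integral>\<omega>. cos (\<tau> * y s \<omega> + d) * (cos ((\<Sum>m\<in>S. t m * y m \<omega>) + c) * V \<omega>) \<partial>M)
        = (\<integral>\<omega>. (cos ((\<Sum>m\<in>insert s S. t1 m * y m \<omega>) + (d + c)) * V \<omega>
            + cos ((\<Sum>m\<in>insert s S. t2 m * y m \<omega>) + (d - c)) * V \<omega>) / 2 \<partial>M)"
        using insert.hyps
      proof (intro Bochner_Integration.integral_cong refl)
        fix \<omega>
        let ?S = "\<Sum>m\<in>S. t m * y m \<omega>"
        have "cos (\<tau> * y s \<omega> + d) * cos (?S + c)
          = (cos (\<tau> * y s \<omega> + ?S + (d + c)) + cos (\<tau> * y s \<omega> - ?S + (d - c))) / 2"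
          by (simp add: cos_times_cos algebra_simps)
        then show "cos (\<tau> * y s \<omega> + d) * (cos (?S + c) * V \<omega>) =
          (cos ((\<Sum>m\<in>insert s S. t1 m * y m \<omega>) + (d + c)) * V \<omega>
            + cos ((\<Sum>m\<in>insert s S. t2 m * y m \<omega>) + (d - c)) * V \<omega>) / 2"
          using insert.hyps ts
          by (simp add: s distrib_right[symmetric] mult.assoc[symmetric])
      qed
      also have "\<dots> = 0"
        using insert.prems(3) i by simp
      finally show ?thesis .
    qed
    then have "(\<integral>\<omega>. indicator (B s) (y s \<omega>) * (cos ((\<Sum>m\<in>S. t m * y m \<omega>) + c) * V \<omega>) \<partial>M) = 0"
      by (intro integral_indicator_vimage_eq_0 meas integrable_mult_bounded[where B = 1])
         (use insert.prems in auto)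
    then show ?thesis by (simp add: V'_def mult_ac)
  qed
  then have "(\<integral>\<omega>. indicator {\<omega>. \<forall>m\<in>S. y m \<omega> \<in> B m} \<omega> * V' \<omega> \<partial>M) = 0"
    using insert.IH[OF _ V'] insert.prems by auto
  moreover have "indicator {\<omega>. \<forall>m\<in>S. y m \<omega> \<in> B m} \<omega> * V' \<omega>
      = indicator {\<omega>. \<forall>m\<in>insert s S. y m \<omega> \<in> B m} \<omega> * V \<omega>" for \<omega>
    by (auto simp: V'_def indicator_def)
  ultimately show ?case by simp
qed

section \<open>Sigma-algebras generated by random vectors, and integration against their
  events\<close>

lemma space_generated [simp]: "space (generated M x K) = space M"
  unfolding generated_def by (rule space_measure_of) auto

lemma sets_generated:
  "sets (generated M x K) = sigma_sets (space M) (\<Union>k\<in>K. {x k -` B \<inter> space M | B. B \<in> sets borel})"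
  unfolding generated_def by (rule sets_measure_of) auto

lemma measurable_generated: "k \<in> K \<Longrightarrow> x k \<in> borel_measurable (generated M x K)"
  by (rule measurableI) (auto simp: sets_generated)

lemma sets_generated_subset:
  assumes "space F = space M" "\<And>k. k \<in> K \<Longrightarrow> x k \<in> borel_measurable F"
  shows "sets (generated M x K) \<subseteq> sets F"
proof -
  have "(\<Union>k\<in>K. {x k -` B \<inter> space M | B. B \<in> sets borel}) \<subseteq> sets F"
  proof (intro UN_least subsetI)
    fix k A assume "k \<in> K" "A \<in> {x k -` B \<inter> space M | B. B \<in> sets borel}"
    then obtain B where "A = x k -` B \<inter> space F" "B \<in> sets borel" using assms(1) by auto
    then show "A \<in> sets F" using assms(2)[OF \<open>k \<in> K\<close>] by (simp add: measurable_sets)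
  qed
  then show ?thesis
    unfolding sets_generated assms(1)[symmetric] by (rule sets.sigma_sets_subset)
qed

lemma subalgebra_generated:
  "(\<And>k. k \<in> K \<Longrightarrow> x k \<in> borel_measurable M) \<Longrightarrow> subalgebra M (generated M x K)"
  by (simp add: subalgebra_def sets_generated_subset)

lemma sets_generated_mono: "K \<subseteq> L \<Longrightarrow> sets (generated M x K) \<subseteq> sets (generated M x L)"
  by (rule sets_generated_subset) (auto intro: measurable_generated)

lemma borel_measurable_nth:
  fixes f :: "'a \<Rightarrow> real^'d"
  assumes "f \<in> borel_measurable M"
  shows "(\<lambda>\<omega>. f \<omega> $ b) \<in> borel_measurable M"
proof -
  have "(\<lambda>\<omega>. f \<omega> \<bullet> axis b 1) \<in> borel_measurable M" using assms by measurable
  then show ?thesis by (simp add: inner_axis)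
qed

text \<open>Dynkin's pi-lambda argument: the coordinate rectangles are stable under intersection and
  generate the sigma-algebra, while the events over which \<open>V\<close> integrates to zero are
  closed under complement, the total integral being zero, and under countable disjoint
  union.\<close>

lemma integral_indicator_generated_eq_0:
  fixes x :: "nat \<Rightarrow> 'a \<Rightarrow> real^'d" and V :: "'a \<Rightarrow> real"
  assumes K: "finite K" and x: "\<And>k. k \<in> K \<Longrightarrow> x k \<in> borel_measurable M" and V: "integrable M V"
    and orth: "\<And>a c. (\<integral>\<omega>. cos ((\<Sum>k\<in>K. a k \<bullet> x k \<omega>) + c) * V \<omega> \<partial>M) = 0"
    and A: "A \<in> sets (generated M x K)"
  shows "(\<integral>\<omega>. indicator A \<omega> * V \<omega> \<partial>M) = 0"
proof -
  define S where "S = K \<times> (UNIV :: 'd set)"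
  define y where "y = (\<lambda>(k, b) \<omega>. x k \<omega> $ b)"
  define R where "R B = {\<omega>. \<forall>m\<in>S. y m \<omega> \<in> B m} \<inter> space M" for B
  define G where "G = {R B | B. \<forall>m\<in>S. B m \<in> sets borel}"
  have y: "y m \<in> borel_measurable M" if "m \<in> S" for m
    using that by (auto simp: S_def y_def intro!: borel_measurable_nth x)
  have sub: "G \<subseteq> Pow (space M)" by (auto simp: G_def R_def)
  have G_sets: "G \<subseteq> sets M"
  proof
    fix g assume "g \<in> G"
    then obtain B where B: "\<And>m. m \<in> S \<Longrightarrow> B m \<in> sets borel" and g: "g = R B" by (auto simp: G_def)
    have "R B = {\<omega>\<in>space M. \<forall>m\<in>S. y m \<omega> \<in> B m}" by (auto simp: R_def)
    also have "\<dots> \<in> sets M"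
      using K B y by (intro sets.sets_Collect_finite_All) (auto simp: S_def intro!: measurable_sets_Collect)
    finally show "g \<in> sets M" using g by simp
  qed
  have stable: "Int_stable G"
  proof (rule Int_stableI)
    fix a b assume "a \<in> G" "b \<in> G"
    then obtain B C where "\<forall>m\<in>S. B m \<in> sets borel" "\<forall>m\<in>S. C m \<in> sets borel" "a = R B" "b = R C"
      by (auto simp: G_def)
    then show "a \<inter> b \<in> G"
      unfolding G_def by (intro CollectI exI[of _ "\<lambda>m. B m \<inter> C m"]) (auto simp: R_def)
  qed
  have sig: "sets (sigma (space M) G) = sigma_sets (space M) G"
    using sub by (rule sets_measure_of)
  have "x k \<in> borel_measurable (sigma (space M) G)" if k: "k \<in> K" for k
  proof -
    have "(\<lambda>\<omega>. x k \<omega> $ b) \<in> borel_measurable (sigma (space M) G)" for b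
    proof (rule measurableI)
      fix B :: "real set" assume B: "B \<in> sets borel"
      have "(\<lambda>\<omega>. x k \<omega> $ b) -` B \<inter> space M = R ((\<lambda>_. UNIV)((k, b) := B))"
        using k by (auto simp: R_def y_def S_def split: if_splits)
      also have "\<dots> \<in> G" unfolding G_def using B by auto
      finally show "(\<lambda>\<omega>. x k \<omega> $ b) -` B \<inter> space (sigma (space M) G) \<in> sets (sigma (space M) G)"
        using sub sig by (simp add: sigma_sets.Basic)
    qed auto
    then show ?thesis
      by (subst borel_measurable_euclidean_space) (auto simp: Basis_vec_def inner_axis)
  qed
  then have "A \<in> sigma_sets (space M) G"
    using sets_generated_subset[of "sigma (space M) G" M K x] A sub sig
    by (auto simp: space_measure_of)
  with stable sub show ?thesis
  proof (induction rule: sigma_sets_induct_disjoint)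
    case (basic A)
    then obtain B where B: "\<And>m. m \<in> S \<Longrightarrow> B m \<in> sets borel" and A: "A = R B"
      by (auto simp: G_def)
    have "(\<integral>\<omega>. indicator {\<omega>. \<forall>m\<in>S. y m \<omega> \<in> B m} \<omega> * V \<omega> \<partial>M) = 0"
    proof (rule integral_indicator_rectangle_eq_0[OF _ y V _ B])
      fix t c
      \<comment> \<open>The scalar frequencies at the coordinates of \<open>x k\<close> reassemble
        into one vector coefficient.\<close>
      have "(\<Sum>m\<in>S. t m * y m \<omega>) = (\<Sum>k\<in>K. (\<chi> b. t (k, b)) \<bullet> x k \<omega>)" for \<omega>
        by (simp add: S_def y_def sum.cartesian_product[symmetric] inner_vec_def
          sum.cartesian_product' split_beta)
      then show "(\<integral>\<omega>. cos ((\<Sum>m\<in>S. t m * y m \<omega>) + c) * V \<omega> \<partial>M) = 0"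
        using orth by simp
    qed (use K in \<open>auto simp: S_def\<close>)
    also have "(\<integral>\<omega>. indicator {\<omega>. \<forall>m\<in>S. y m \<omega> \<in> B m} \<omega> * V \<omega> \<partial>M) = (\<integral>\<omega>. indicator A \<omega> * V \<omega> \<partial>M)"
      by (intro Bochner_Integration.integral_cong) (auto simp: A R_def indicator_def)
    finally show ?case .
  next
    case empty
    show ?case by simp
  next
    case (compl A)
    have AM: "A \<in> sets M" using compl(1) G_sets sets.sigma_sets_subset by blast
    have "(\<integral>\<omega>. indicator (space M - A) \<omega> * V \<omega> \<partial>M) = (\<integral>\<omega>. V \<omega> - indicator A \<omega> * V \<omega> \<partial>M)"
      by (intro Bochner_Integration.integral_cong) (auto simp: indicator_def)
    also have "\<dots> = (\<integral>\<omega>. V \<omega> \<partial>M) - (\<integral>\<omega>. indicator A \<omega> * V \<omega> \<partial>M)"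
      using V AM by (intro Bochner_Integration.integral_diff integrable_mult_bounded[where B = 1])
        (auto simp: indicator_def)
    also have "\<dots> = 0" using orth[of "\<lambda>_. 0" 0] compl by simp
    finally show ?case .
  next
    case (union A)
    have AM: "A i \<in> sets M" for i
      using union(2) G_sets sets.sigma_sets_subset by blast
    have "set_lebesgue_integral M (\<Union>i. A i) V = (\<Sum>i. set_lebesgue_integral M (A i) V)"
      using AM union(1) V
      by (intro lebesgue_integral_countable_add)
         (auto simp: disjoint_family_on_def set_integrable_def simp del: real_scaleR_def
           intro!: integrable_mult_indicator)
    also have "\<dots> = 0" using union(3) by (simp add: set_lebesgue_integral_def)
    finally show ?case by (simp add: set_lebesgue_integral_def)
  qed
qed

text \<open>Hypothesis \<open>ind\<close> says that the conditional expectation of \<open>V\<close>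
  given \<open>F\<close> vanishes, and an \<open>F\<close>-measurable factor can be pulled out of
  it. The factor \<open>f\<close> may be unbounded.\<close>

lemma (in finite_measure_subalgebra) integral_mult_eq_0:
  assumes V: "integrable M V" and ind: "\<And>A. A \<in> sets F \<Longrightarrow> (\<integral>\<omega>. indicator A \<omega> * V \<omega> \<partial>M) = 0"
    and f [measurable]: "f \<in> borel_measurable F" and int: "integrable M (\<lambda>\<omega>. f \<omega> * V \<omega>)"
  shows "(\<integral>\<omega>. f \<omega> * V \<omega> \<partial>M) = (0::real)"
proof -
  have [measurable]: "f \<in> borel_measurable M" using measurable_from_subalg[OF subalg f] .
  have "AE \<omega> in M. real_cond_exp M F V \<omega> = 0"
    using V ind by (intro real_cond_exp_charact) (auto simp: set_lebesgue_integral_def)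
  then have "(\<integral>\<omega>. f \<omega> * real_cond_exp M F V \<omega> \<partial>M) = 0"
    by (intro integral_eq_zero_AE) auto
  then show ?thesis using real_cond_exp_intg(2)[OF int f] V by simp
qed

text \<open>Passes from bounded cosine tests to the unbounded factor \<open>X\<close> itself, by way
  of the sigma-algebra generated by \<open>X\<close>.\<close>

lemma (in finite_measure) integral_mult_self_eq_0:
  fixes X V :: "'a \<Rightarrow> real"
  assumes X: "X \<in> borel_measurable M" and V: "integrable M V"
    and orth: "\<And>t c. (\<integral>\<omega>. cos (t * X \<omega> + c) * V \<omega> \<partial>M) = 0"
    and int: "integrable M (\<lambda>\<omega>. X \<omega> * V \<omega>)"
  shows "(\<integral>\<omega>. X \<omega> * V \<omega> \<partial>M) = 0"
proof -
  define F where "F = vimage_algebra (space M) X borel"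
  interpret F: finite_measure_subalgebra M F
    using X by unfold_locales (auto simp: F_def subalgebra_def sets_vimage_algebra2 measurable_sets)
  show ?thesis
  proof (rule F.integral_mult_eq_0[OF V _ _ int])
    show "X \<in> borel_measurable F" unfolding F_def by (rule measurable_vimage_algebra1) auto
    fix A assume "A \<in> sets F"
    then obtain B where A: "A = X -` B \<inter> space M" and B: "B \<in> sets borel"
      by (auto simp: F_def sets_vimage_algebra2)
    have "(\<integral>\<omega>. indicator A \<omega> * V \<omega> \<partial>M) = (\<integral>\<omega>. indicator B (X \<omega>) * V \<omega> \<partial>M)"
      by (intro Bochner_Integration.integral_cong) (auto simp: A indicator_def)
    also have "\<dots> = 0" by (rule integral_indicator_vimage_eq_0[OF X V orth B])
    finally show "(\<integral>\<omega>. indicator A \<omega> * V \<omega> \<partial>M) = 0" .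
  qed
qed

section \<open>Gaussian spaces\<close>

lemma (in prob_space) gaussian_rv_integrable:
  assumes "gaussian_rv M X"
  shows "integrable M X" "integrable M (\<lambda>\<omega>. (X \<omega>)\<^sup>2)"
proof -
  have [measurable]: "X \<in> borel_measurable M" using assms by (simp add: gaussian_rv_def)
  have "integrable M X \<and> integrable M (\<lambda>\<omega>. (X \<omega>)\<^sup>2)"
    using assms[unfolded gaussian_rv_def]
  proof (elim conjE disjE exE)
    fix \<mu> \<sigma> :: real assume \<sigma>: "0 < \<sigma>" and D: "distributed M lborel X (normal_density \<mu> \<sigma>)"
    have i: "integrable M (\<lambda>\<omega>. (X \<omega> - \<mu>) ^ k)" for k
      using integrable_normal_moment[OF \<sigma>, of \<mu> k]
      by (subst distributed_integrable[OF D, symmetric]) auto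
    have "integrable M (\<lambda>\<omega>. (X \<omega> - \<mu>) ^ 1 + \<mu>)"
      by (intro Bochner_Integration.integrable_add i) auto
    moreover have "integrable M (\<lambda>\<omega>. (X \<omega> - \<mu>) ^ 2 + 2 * \<mu> * (X \<omega> - \<mu>) ^ 1 + \<mu>\<^sup>2)"
      by (intro Bochner_Integration.integrable_add integrable_mult_right i) auto
    moreover have "(X \<omega> - \<mu>) ^ 2 + 2 * \<mu> * (X \<omega> - \<mu>) ^ 1 + \<mu>\<^sup>2 = (X \<omega>)\<^sup>2" for \<omega>
      by (simp add: power2_eq_square algebra_simps)
    ultimately show ?thesis by simp
  next
    fix \<mu> assume \<mu>: "AE \<omega> in M. X \<omega> = \<mu>"
    have "integrable M X = integrable M (\<lambda>_. \<mu>)"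
      using \<mu> by (intro integrable_cong_AE) auto
    moreover have "integrable M (\<lambda>\<omega>. (X \<omega>)\<^sup>2) = integrable M (\<lambda>_. \<mu>\<^sup>2)"
      using \<mu> by (intro integrable_cong_AE) auto
    ultimately show ?thesis by simp
  qed
  then show "integrable M X" "integrable M (\<lambda>\<omega>. (X \<omega>)\<^sup>2)" by auto
qed

text \<open>This is the real part of the characteristic function of a normal law, rotated by the
  phase \<open>c\<close>. A point mass obeys the same formula with variance zero, so degenerate
  variables are treated uniformly from here on.\<close>

lemma (in prob_space) gaussian_rv_cos:
  assumes "gaussian_rv M X"
  shows "(\<integral>\<omega>. cos (X \<omega> + c) \<partial>M) = exp (- covariance M X X / 2) * cos (expectation X + c)"
proof -
  have [measurable]: "X \<in> borel_measurable M" using assms by (simp add: gaussian_rv_def)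
  show ?thesis using assms[unfolded gaussian_rv_def]
  proof (elim conjE disjE exE)
    fix \<mu> \<sigma> :: real assume \<sigma>: "0 < \<sigma>" and D: "distributed M lborel X (normal_density \<mu> \<sigma>)"
    have E: "expectation X = \<mu>" using normal_distributed_expectation[OF \<sigma> D] .
    have C: "covariance M X X = \<sigma>\<^sup>2"
      using normal_distributed_variance[OF \<sigma> D] by (simp add: covariance_def power2_eq_square)
    \<comment> \<open>Standardizing brings in the characteristic function of the standard normal
      law, evaluated at \<sigma>.\<close>
    define Z where "Z \<omega> = (X \<omega> - \<mu>) / \<sigma>" for \<omega>
    have Zm [measurable]: "Z \<in> borel_measurable M" unfolding Z_def by measurable
    have Z: "distributed M lborel Z std_normal_density"
      using D normal_standard_normal_convert[OF \<sigma>, of X \<mu>] by (simp add: Z_def[abs_def])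
    have "distr M borel Z = distr M lborel Z" by (rule distr_cong) auto
    then have "distr M borel Z = std_normal_distribution"
      using Z by (simp add: distributed_def)
    then have ch: "(CLINT \<omega>|M. iexp (\<sigma> * Z \<omega>)) = complex_of_real (exp (- (\<sigma>^2) / 2))"
      using fun_cong[OF char_std_normal_distribution, of \<sigma>]
      by (simp add: char_def integral_distr flip: \<open>distr M borel Z = std_normal_distribution\<close>)
    have int: "complex_integrable M (\<lambda>\<omega>. iexp (\<sigma> * Z \<omega>) * iexp (\<mu> + c))"
      by (rule integrable_const_bound[where B = 1]) (auto simp: norm_mult)
    have "cos (X \<omega> + c) = Re (iexp (\<sigma> * Z \<omega>) * iexp (\<mu> + c))" for \<omega>
    proof -
      have "\<sigma> * Z \<omega> = X \<omega> - \<mu>" using \<sigma> by (simp add: Z_def)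
      then have "iexp (\<sigma> * Z \<omega>) * iexp (\<mu> + c) = iexp (X \<omega> + c)"
        by (simp only: exp_add[symmetric]) (simp add: algebra_simps)
      then show ?thesis by (simp only: cis_conv_exp[symmetric] cis.simps)
    qed
    then have "(\<integral>\<omega>. cos (X \<omega> + c) \<partial>M) = Re (CLINT \<omega>|M. iexp (\<sigma> * Z \<omega>) * iexp (\<mu> + c))"
      using integral_Re[OF int] by simp
    also have "\<dots> = exp (- (\<sigma>^2) / 2) * cos (\<mu> + c)"
      by (simp add: ch del: of_real_add of_real_mult of_real_exp) (simp add: Re_exp)
    finally show ?thesis by (simp add: E C)
  next
    fix \<mu> assume \<mu>: "AE \<omega> in M. X \<omega> = \<mu>"
    then have E: "expectation X = \<mu>"
      using integral_cong_AE[of X M "\<lambda>_. \<mu>"] by (simp add: prob_space)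
    have "covariance M X X = (\<integral>\<omega>. 0 \<partial>M)"
      unfolding covariance_def E using \<mu> by (intro integral_cong_AE) auto
    moreover have "(\<integral>\<omega>. cos (X \<omega> + c) \<partial>M) = (\<integral>\<omega>. cos (\<mu> + c) \<partial>M)"
      using \<mu> by (intro integral_cong_AE) auto
    ultimately show ?thesis by (simp add: E prob_space)
  qed
qed

text \<open>Closure under linear combinations turns Gaussianity of single members into joint
  Gaussianity. Members need not be centred, and covariance acts on \<open>H\<close> as a possibly
  degenerate inner product.\<close>

locale gaussian_space = prob_space M for M :: "'a measure" +
  fixes H :: "('a \<Rightarrow> real) set"
  assumes gaussian: "X \<in> H \<Longrightarrow> gaussian_rv M X"
    and zero [intro, simp]: "(\<lambda>_. 0) \<in> H"
    and add [intro]: "X \<in> H \<Longrightarrow> Y \<in> H \<Longrightarrow> (\<lambda>\<omega>. X \<omega> + Y \<omega>) \<in> H"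
    and cmult [intro]: "X \<in> H \<Longrightarrow> (\<lambda>\<omega>. r * X \<omega>) \<in> H"
begin

lemma uminus [intro]: "X \<in> H \<Longrightarrow> (\<lambda>\<omega>. - X \<omega>) \<in> H"
  using cmult[of X "- 1"] by simp

lemma diff [intro]: "X \<in> H \<Longrightarrow> Y \<in> H \<Longrightarrow> (\<lambda>\<omega>. X \<omega> - Y \<omega>) \<in> H"
  using add[of X "\<lambda>\<omega>. - Y \<omega>"] by auto

lemma sum [intro]: "(\<And>i. i \<in> I \<Longrightarrow> X i \<in> H) \<Longrightarrow> (\<lambda>\<omega>. \<Sum>i\<in>I. X i \<omega>) \<in> H"
  by (induction I rule: infinite_finite_induct) auto

lemma measurable_H: "X \<in> H \<Longrightarrow> X \<in> borel_measurable M"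
  using gaussian by (simp add: gaussian_rv_def)

lemma integrable_H: "X \<in> H \<Longrightarrow> integrable M X"
  using gaussian gaussian_rv_integrable by blast

lemma integrable_mult_H: "X \<in> H \<Longrightarrow> Y \<in> H \<Longrightarrow> integrable M (\<lambda>\<omega>. X \<omega> * Y \<omega>)"
proof -
  assume X: "X \<in> H" and Y: "Y \<in> H"
  \<comment> \<open>Polarization expresses the product through squares of members of
    \<open>H\<close>.\<close>
  have "integrable M (\<lambda>\<omega>. ((X \<omega> + Y \<omega>)\<^sup>2 - (X \<omega>)\<^sup>2 - (Y \<omega>)\<^sup>2) / 2)"
    using gaussian_rv_integrable(2)[OF gaussian] X Y add[OF X Y] by auto
  moreover have "((X \<omega> + Y \<omega>)\<^sup>2 - (X \<omega>)\<^sup>2 - (Y \<omega>)\<^sup>2) / 2 = X \<omega> * Y \<omega>" for \<omega>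
    by (simp add: power2_eq_square algebra_simps)
  ultimately show ?thesis by simp
qed

section \<open>Covariance as a bilinear form on the Gaussian space\<close>

lemma covariance_eq:
  assumes "X \<in> H" "Y \<in> H"
  shows "covariance M X Y = expectation (\<lambda>\<omega>. X \<omega> * Y \<omega>) - expectation X * expectation Y"
proof -
  have "covariance M X Y = expectation (\<lambda>\<omega>. X \<omega> * Y \<omega> - expectation X * Y \<omega> - expectation Y * X \<omega>
      + expectation X * expectation Y)"
    unfolding covariance_def by (intro Bochner_Integration.integral_cong) (auto simp: algebra_simps)
  then show ?thesis
    using assms integrable_H integrable_mult_H by (simp add: prob_space)
qed

lemma covariance_commute: "covariance M X Y = covariance M Y X"
  unfolding covariance_def by (simp add: mult.commute)

lemma covariance_zero_left [simp]: "covariance M (\<lambda>_. 0) Y = 0"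
  by (simp add: covariance_def)

lemma covariance_add_left:
  "X \<in> H \<Longrightarrow> Y \<in> H \<Longrightarrow> Z \<in> H \<Longrightarrow>
    covariance M (\<lambda>\<omega>. X \<omega> + Y \<omega>) Z = covariance M X Z + covariance M Y Z"
  by (simp add: covariance_eq add integrable_H integrable_mult_H distrib_right)

lemma covariance_cmult_left:
  "X \<in> H \<Longrightarrow> Z \<in> H \<Longrightarrow> covariance M (\<lambda>\<omega>. r * X \<omega>) Z = r * covariance M X Z"
  by (simp add: covariance_eq cmult mult.assoc right_diff_distrib)

lemma covariance_diff_left:
  "X \<in> H \<Longrightarrow> Y \<in> H \<Longrightarrow> Z \<in> H \<Longrightarrow>
    covariance M (\<lambda>\<omega>. X \<omega> - Y \<omega>) Z = covariance M X Z - covariance M Y Z"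
  using covariance_add_left[of X "\<lambda>\<omega>. -1 * Y \<omega>" Z] covariance_cmult_left[of Y Z "-1"] cmult[of Y "-1"]
  by simp

lemma covariance_sum_left:
  "(\<And>i. i \<in> I \<Longrightarrow> X i \<in> H) \<Longrightarrow> Z \<in> H \<Longrightarrow>
    covariance M (\<lambda>\<omega>. \<Sum>i\<in>I. X i \<omega>) Z = (\<Sum>i\<in>I. covariance M (X i) Z)"
  by (induction I rule: infinite_finite_induct) (auto simp: covariance_add_left sum)

lemma covariance_add_right:
  "X \<in> H \<Longrightarrow> Y \<in> H \<Longrightarrow> Z \<in> H \<Longrightarrow>
    covariance M Z (\<lambda>\<omega>. X \<omega> + Y \<omega>) = covariance M Z X + covariance M Z Y"
  using covariance_add_left[of X Y Z] by (simp add: covariance_commute)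

lemma covariance_diff_right:
  "X \<in> H \<Longrightarrow> Y \<in> H \<Longrightarrow> Z \<in> H \<Longrightarrow>
    covariance M Z (\<lambda>\<omega>. X \<omega> - Y \<omega>) = covariance M Z X - covariance M Z Y"
  using covariance_diff_left[of X Y Z] by (simp add: covariance_commute)

lemma covariance_sum_right:
  "(\<And>i. i \<in> I \<Longrightarrow> X i \<in> H) \<Longrightarrow> Z \<in> H \<Longrightarrow>
    covariance M Z (\<lambda>\<omega>. \<Sum>i\<in>I. X i \<omega>) = (\<Sum>i\<in>I. covariance M Z (X i))"
  using covariance_sum_left[of I X Z] by (simp add: covariance_commute)

text \<open>Zero variance forces \<open>X\<close> to be almost everywhere constant. This is what
  lets the regression arguments below survive singular covariance matrices.\<close>

lemma covariance_self_eq_0D: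
  assumes X: "X \<in> H" and 0: "covariance M X X = 0"
  shows "covariance M X Y = 0"
proof -
  have [measurable]: "X \<in> borel_measurable M" using X by (rule measurable_H)
  let ?c = "\<lambda>\<omega>. (X \<omega> - expectation X) * (X \<omega> - expectation X)"
  have "integrable M (\<lambda>\<omega>. X \<omega> * X \<omega> - 2 * expectation X * X \<omega> + expectation X * expectation X)"
    using integrable_mult_H[OF X X] integrable_H[OF X] by auto
  moreover have "X \<omega> * X \<omega> - 2 * expectation X * X \<omega> + expectation X * expectation X = ?c \<omega>" for \<omega>
    by (simp add: algebra_simps)
  ultimately have "integrable M ?c" by simp
  then have "AE \<omega> in M. ?c \<omega> = 0"
    using 0 integral_nonneg_eq_0_iff_AE[of M ?c] by (auto simp: covariance_def)
  then have "AE \<omega> in M. (X \<omega> - expectation X) * (Y \<omega> - expectation Y) = 0"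
    by eventually_elim simp
  then show ?thesis unfolding covariance_def by (rule integral_eq_zero_AE)
qed

text \<open>Variances of uncorrelated members add, so the exponential factor splits:
  \<open>Y\<close> may be replaced by its mean at the price of the factor belonging to its own
  variance.\<close>

lemma expectation_cos_add:
  assumes Y: "Y \<in> H" and Z: "Z \<in> H" and uncorr: "covariance M Y Z = 0"
  shows "(\<integral>\<omega>. cos (Y \<omega> + Z \<omega> + c) \<partial>M)
    = exp (- covariance M Y Y / 2) * (\<integral>\<omega>. cos (expectation Y + Z \<omega> + c) \<partial>M)"
proof -
  have "covariance M (\<lambda>\<omega>. Y \<omega> + Z \<omega>) (\<lambda>\<omega>. Y \<omega> + Z \<omega>) = covariance M Y Y + covariance M Z Z"
    using Y Z uncorr covariance_commute[of Z Y]
    by (simp add: covariance_add_left covariance_add_right add)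
  moreover have "expectation (\<lambda>\<omega>. Y \<omega> + Z \<omega>) = expectation Y + expectation Z"
    using Y Z integrable_H by simp
  ultimately show ?thesis
    using gaussian_rv_cos[OF gaussian[OF add[OF Y Z]], of c]
      gaussian_rv_cos[OF gaussian[OF Z], of "expectation Y + c"]
    by (simp add: add_ac exp_add[symmetric] mult.assoc[symmetric] add_divide_distrib)
qed

end

section \<open>Conditional independence and residuals\<close>

context gaussian_space
begin

text \<open>Localizes the preceding factorization to an event determined by \<open>x\<close> on
  \<open>J\<close>. Being uncorrelated with these vectors and with \<open>Z\<close>, the variable
  \<open>R\<close> is in effect independent of them jointly and can be integrated out while the
  event and \<open>Z\<close> stay in place.\<close>

lemma integral_indicator_cos_add:
  fixes x :: "nat \<Rightarrow> 'a \<Rightarrow> real^'d"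
  assumes J: "finite J" "\<And>m. m \<in> J \<Longrightarrow> x m \<in> borel_measurable M"
      "\<And>m b. m \<in> J \<Longrightarrow> (\<lambda>\<omega>. b \<bullet> x m \<omega>) \<in> H"
    and R: "R \<in> H" and Z: "Z \<in> H"
    and uncorr: "\<And>m b. m \<in> J \<Longrightarrow> covariance M R (\<lambda>\<omega>. b \<bullet> x m \<omega>) = 0" "covariance M R Z = 0"
    and A: "A \<in> sets (generated M x J)"
  shows "(\<integral>\<omega>. indicator A \<omega> * cos (R \<omega> + Z \<omega> + c) \<partial>M)
    = exp (- covariance M R R / 2) * (\<integral>\<omega>. indicator A \<omega> * cos (expectation R + Z \<omega> + c) \<partial>M)"
proof -
  have [measurable]: "R \<in> borel_measurable M" "Z \<in> borel_measurable M"
    using R Z measurable_H by auto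
  have [measurable]: "A \<in> sets M"
    using A subalgebra_generated[of J x M] J(2) by (auto simp: subalgebra_def)
  define \<kappa> where "\<kappa> = exp (- covariance M R R / 2)"
  \<comment> \<open>The claim is that \<open>V\<close> integrates to zero over \<open>A\<close>, so
    it suffices to test \<open>V\<close> against cosines of linear functionals of \<open>x\<close>
    on \<open>J\<close>.\<close>
  define V where "V \<omega> = cos (R \<omega> + Z \<omega> + c) - \<kappa> * cos (expectation R + Z \<omega> + c)" for \<omega>
  have int: "integrable M f" if "f \<in> borel_measurable M" "\<And>\<omega>. \<bar>f \<omega>\<bar> \<le> 1" for f :: "'a \<Rightarrow> real"
    using that by (intro integrable_const_bound[where B = 1]) auto
  have V: "integrable M V"
    unfolding V_def by (intro Bochner_Integration.integrable_diff integrable_mult_right int) auto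
  have "(\<integral>\<omega>. indicator A \<omega> * V \<omega> \<partial>M) = 0"
  proof (rule integral_indicator_generated_eq_0[OF J(1,2) V _ A])
    fix a d
    define W where "W \<omega> = (\<Sum>k\<in>J. a k \<bullet> x k \<omega>)" for \<omega>
    have W: "W \<in> H" unfolding W_def using J(3) by (intro sum)
    then have [measurable]: "W \<in> borel_measurable M" by (rule measurable_H)
    have cW: "covariance M R W = 0"
      unfolding W_def using R J(3) uncorr(1) by (subst covariance_sum_right) auto
    have ZW: "(\<lambda>\<omega>. Z \<omega> + W \<omega>) \<in> H" "(\<lambda>\<omega>. Z \<omega> - W \<omega>) \<in> H"
      "covariance M R (\<lambda>\<omega>. Z \<omega> + W \<omega>) = 0" "covariance M R (\<lambda>\<omega>. Z \<omega> - W \<omega>) = 0"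
      using Z W R uncorr(2) cW add diff by (auto simp: covariance_add_right covariance_diff_right)
    \<comment> \<open>Multiplication by the test cosine only changes \<open>Z\<close> into
      \<open>Z + W\<close> or \<open>Z - W\<close>, both still uncorrelated with
      \<open>R\<close>.\<close>
    have p: "cos (W \<omega> + d) * cos (Q + Z \<omega> + c)
        = (cos (Q + (Z \<omega> + W \<omega>) + (c + d)) + cos (Q + (Z \<omega> - W \<omega>) + (c - d))) / 2" for \<omega> Q
      using cos_times_cos[of "Q + Z \<omega> + c" "W \<omega> + d"] by (simp add: algebra_simps)
    have "(\<integral>\<omega>. cos (W \<omega> + d) * V \<omega> \<partial>M)
      = (\<integral>\<omega>. (cos (R \<omega> + (Z \<omega> + W \<omega>) + (c + d)) + cos (R \<omega> + (Z \<omega> - W \<omega>) + (c - d))) / 2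
          - \<kappa> * ((cos (expectation R + (Z \<omega> + W \<omega>) + (c + d))
              + cos (expectation R + (Z \<omega> - W \<omega>) + (c - d))) / 2) \<partial>M)"
      by (simp only: V_def right_diff_distrib mult.left_commute[of _ \<kappa>] p)
    also have "\<dots> = ((\<integral>\<omega>. cos (R \<omega> + (Z \<omega> + W \<omega>) + (c + d)) \<partial>M)
          + (\<integral>\<omega>. cos (R \<omega> + (Z \<omega> - W \<omega>) + (c - d)) \<partial>M)) / 2
        - \<kappa> * (((\<integral>\<omega>. cos (expectation R + (Z \<omega> + W \<omega>) + (c + d)) \<partial>M)
          + (\<integral>\<omega>. cos (expectation R + (Z \<omega> - W \<omega>) + (c - d)) \<partial>M)) / 2)"
      by (simp add: int)
    also have "\<dots> = 0"
      unfolding expectation_cos_add[OF R ZW(1,3)] expectation_cos_add[OF R ZW(2,4)] \<kappa>_def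
      by (simp add: algebra_simps)
    finally show "(\<integral>\<omega>. cos ((\<Sum>k\<in>J. a k \<bullet> x k \<omega>) + d) * V \<omega> \<partial>M) = 0"
      by (simp add: W_def)
  qed
  moreover have "(\<integral>\<omega>. indicator A \<omega> * V \<omega> \<partial>M)
      = (\<integral>\<omega>. indicator A \<omega> * cos (R \<omega> + Z \<omega> + c)
          - \<kappa> * (indicator A \<omega> * cos (expectation R + Z \<omega> + c)) \<partial>M)"
    by (intro Bochner_Integration.integral_cong) (auto simp: V_def algebra_simps)
  moreover have "integrable M (\<lambda>\<omega>. indicator A \<omega> * cos (Y \<omega>))"
    if [measurable]: "Y \<in> borel_measurable M" for Y :: "'a \<Rightarrow> real"
    by (rule int) (auto simp: indicator_def)
  ultimately show ?thesis by (simp add: \<kappa>_def)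
qed

text \<open>A linear functional of the \<open>K\<close> variables is a residual plus a regression on
  \<open>J\<close>. The residual is independent of \<open>J\<close> and \<open>L\<close> together,
  so conditioning the cosine of the functional on both gives a \<open>J\<close>-measurable variable.
  Hence, on an event of \<open>J\<close>, replacing \<open>indicator B\<close> by its conditional
  expectation \<open>h\<close> changes no integral against such cosines, and therefore none against
  events of \<open>K\<close>.\<close>

lemma cond_indep_if_residuals_uncorrelated:
  fixes x :: "nat \<Rightarrow> 'a \<Rightarrow> real^'d"
  assumes fin: "finite J" "finite K" "finite L"
    and x: "\<And>m. m \<in> J \<union> K \<union> L \<Longrightarrow> x m \<in> borel_measurable M"
      "\<And>m b. m \<in> J \<union> K \<union> L \<Longrightarrow> (\<lambda>\<omega>. b \<bullet> x m \<omega>) \<in> H"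
    and res: "\<And>k a. k \<in> K \<Longrightarrow> \<exists>w. \<forall>m\<in>J \<union> L. \<forall>b.
      covariance M (\<lambda>\<omega>. a \<bullet> x k \<omega> - (\<Sum>m\<in>J. w m \<bullet> x m \<omega>)) (\<lambda>\<omega>. b \<bullet> x m \<omega>) = 0"
  shows "cond_indep M (generated M x J) (generated M x K) (generated M x L)"
  unfolding cond_indep_def
proof (intro ballI)
  fix A B assume A: "A \<in> sets (generated M x K)" and B: "B \<in> sets (generated M x L)"
  define G where "G = generated M x J"
  have sub: "subalgebra M (generated M x S)" if "S \<subseteq> J \<union> K \<union> L" for S
    using x(1) that by (intro subalgebra_generated) auto
  interpret G: finite_measure_subalgebra M G
    using sub[of J] by unfold_locales (auto simp: G_def)
  have [measurable]: "A \<in> sets M" "B \<in> sets M"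
    using A B sub[of K] sub[of L] by (auto simp: subalgebra_def)
  define hA where "hA = real_cond_exp M G (indicator A)"
  define h where "h = real_cond_exp M G (indicator B)"
  have int_ind: "integrable M (indicator A :: 'a \<Rightarrow> real)" "integrable M (indicator B :: 'a \<Rightarrow> real)"
    by (simp_all add: emeasure_eq_measure)
  have h: "integrable M h" unfolding h_def using int_ind by (intro G.real_cond_exp_int)
  have h_G: "h \<in> borel_measurable G" "hA \<in> borel_measurable G" by (auto simp: h_def hA_def)
  have h_M [measurable]: "h \<in> borel_measurable M" "hA \<in> borel_measurable M"
    by (auto simp: h_def hA_def)
  have bd: "integrable M (\<lambda>\<omega>. f \<omega> * g \<omega>)"
    if "integrable M g" "f \<in> borel_measurable M" "\<And>\<omega>. \<bar>f \<omega>\<bar> \<le> 1" for f g :: "'a \<Rightarrow> real"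
    using that by (rule integrable_mult_bounded)
  have ibd: "integrable M (\<lambda>\<omega>. indicator C \<omega> * g \<omega>)"
    if "integrable M g" "C \<in> sets M" for g :: "'a \<Rightarrow> real" and C
    using that by (intro bd) (auto simp: indicator_def)
  have hA1: "integrable M (\<lambda>\<omega>. h \<omega> * indicator A \<omega>)"
    using ibd[OF h, of A] by (simp add: mult.commute)
  have hhA: "integrable M (\<lambda>\<omega>. h \<omega> * hA \<omega>)"
    unfolding hA_def using G.real_cond_exp_intg(1)[OF hA1 h_G(1)] by simp
  have "AE \<omega> in M. real_cond_exp M G (indicator (A \<inter> B)) \<omega> = hA \<omega> * h \<omega>"
  proof (rule G.real_cond_exp_charact)
    fix C assume C: "C \<in> sets G"
    then have [measurable]: "C \<in> sets M" using G.subalg by (auto simp: subalgebra_def)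
    have C_G [measurable]: "indicator C \<in> borel_measurable G" using C by simp
    \<comment> \<open>Orthogonality of \<open>V\<close> to \<open>indicator A\<close> is the
      identity characterizing the conditional expectation of \<open>A \<inter> B\<close>, once
      \<open>indicator A\<close> is replaced by \<open>hA\<close> next to \<open>h\<close>.\<close>
    define V where "V \<omega> = indicator C \<omega> * (indicator B \<omega> - h \<omega>)" for \<omega>
    have V: "integrable M V" unfolding V_def
      by (intro ibd Bochner_Integration.integrable_diff int_ind h) measurable
    have "(\<integral>\<omega>. indicator A \<omega> * V \<omega> \<partial>M) = 0"
    proof (rule integral_indicator_generated_eq_0[OF fin(2) _ V _ A])
      fix a c
      have "\<forall>k\<in>K. \<exists>w. \<forall>m\<in>J \<union> L. \<forall>b.
        covariance M (\<lambda>\<omega>. a k \<bullet> x k \<omega> - (\<Sum>m\<in>J. w m \<bullet> x m \<omega>)) (\<lambda>\<omega>. b \<bullet> x m \<omega>) = 0"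
        using res by (intro ballI)
      from bchoice[OF this] obtain w where w: "\<forall>k\<in>K. \<forall>m\<in>J \<union> L. \<forall>b.
        covariance M (\<lambda>\<omega>. a k \<bullet> x k \<omega> - (\<Sum>m\<in>J. w k m \<bullet> x m \<omega>)) (\<lambda>\<omega>. b \<bullet> x m \<omega>) = 0" ..
      define Y where "Y \<omega> = (\<Sum>k\<in>K. a k \<bullet> x k \<omega>)" for \<omega>
      \<comment> \<open>Summation over \<open>K\<close> splits \<open>Y\<close> into the total
        residual \<open>R\<close> and the total regression \<open>Z\<close>, a functional of the
        \<open>J\<close> variables alone.\<close>
      define R where "R \<omega> = (\<Sum>k\<in>K. a k \<bullet> x k \<omega> - (\<Sum>m\<in>J. w k m \<bullet> x m \<omega>))" for \<omega>
      define Z where "Z \<omega> = (\<Sum>m\<in>J. (\<Sum>k\<in>K. w k m) \<bullet> x m \<omega>)" for \<omega>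
      have Y: "Y \<omega> = R \<omega> + Z \<omega>" for \<omega>
        unfolding Y_def R_def Z_def
        by (simp add: sum_subtractf inner_sum_left sum.swap[of _ K J])
      have rH: "(\<lambda>\<omega>. a k \<bullet> x k \<omega> - (\<Sum>m\<in>J. w k m \<bullet> x m \<omega>)) \<in> H" if "k \<in> K" for k
        using x(2) that by (intro diff sum) auto
      have R: "R \<in> H" unfolding R_def by (intro sum rH)
      have Z: "Z \<in> H" unfolding Z_def using x(2) by (intro sum) auto
      have [measurable]: "R \<in> borel_measurable M" "Z \<in> borel_measurable M"
        using R Z measurable_H by auto
      have uR: "covariance M R (\<lambda>\<omega>. b \<bullet> x m \<omega>) = 0" if "m \<in> J \<union> L" for m b
        unfolding R_def using that x(2) w rH by (subst covariance_sum_left) auto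
      then have uZ: "covariance M R Z = 0"
        unfolding Z_def using R x(2) by (subst covariance_sum_right) auto
      \<comment> \<open>\<open>\<kappa> * g\<close> is the conditional expectation of \<open>cos (Y + c)\<close>, both given \<open>J\<close> and given \<open>J \<union> L\<close>.\<close>
      define \<kappa> where "\<kappa> = exp (- covariance M R R / 2)"
      define g where "g \<omega> = cos (expectation R + Z \<omega> + c)" for \<omega>
      have g_G: "g \<in> borel_measurable G"
        unfolding g_def Z_def G_def
        by (intro borel_measurable_continuous_on[of cos] continuous_intros borel_measurable_add
          borel_measurable_sum borel_measurable_inner borel_measurable_const measurable_generated)
      have [measurable]: "g \<in> borel_measurable M"
        using measurable_from_subalg[OF G.subalg g_G] .
      have cos_ind: "(\<integral>\<omega>. indicator D \<omega> * cos (Y \<omega> + c) \<partial>M) = \<kappa> * (\<integral>\<omega>. indicator D \<omega> * g \<omega> \<partial>M)"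
        if "D \<in> sets (generated M x (J \<union> L))" for D
        unfolding Y \<kappa>_def g_def
        by (rule integral_indicator_cos_add[OF _ _ _ R Z uR uZ that]) (use fin x in auto)
      define U where "U \<omega> = cos (Y \<omega> + c) - \<kappa> * g \<omega>" for \<omega>
      have [measurable]: "Y \<in> borel_measurable M" unfolding Y by measurable
      have b1: "integrable M (\<lambda>\<omega>. cos (Y \<omega> + c))" "integrable M g"
        by (auto simp: g_def intro!: integrable_const_bound[where B = 1])
      then have U: "integrable M U" unfolding U_def by auto
      \<comment> \<open>\<open>U\<close> integrates to zero over every event of \<open>G\<close>,
        hence also against the \<open>G\<close>-measurable weight
        \<open>indicator C * h\<close>.\<close>
      have "(\<integral>\<omega>. (indicator C \<omega> * h \<omega>) * U \<omega> \<partial>M) = 0"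
      proof (rule G.integral_mult_eq_0[OF U])
        show "(\<lambda>\<omega>. indicator C \<omega> * h \<omega>) \<in> borel_measurable G" using h_G by measurable
        have "integrable M (\<lambda>\<omega>. U \<omega> * (indicator C \<omega> * h \<omega>))"
        proof (rule integrable_mult_bounded[where B = "1 + \<bar>\<kappa>\<bar>"])
          show "\<bar>U \<omega>\<bar> \<le> 1 + \<bar>\<kappa>\<bar>" for \<omega>
          proof -
            have "\<bar>\<kappa> * g \<omega>\<bar> \<le> \<bar>\<kappa>\<bar> * 1" unfolding abs_mult g_def by (intro mult_left_mono) auto
            moreover have "\<bar>cos (Y \<omega> + c)\<bar> \<le> 1" by simp
            ultimately show ?thesis unfolding U_def by linarith
          qed
        qed (use h U in \<open>auto simp: indicator_def intro!: bd\<close>)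
        then show "integrable M (\<lambda>\<omega>. indicator C \<omega> * h \<omega> * U \<omega>)" by (simp add: mult_ac)
        fix D assume "D \<in> sets G"
        then have D: "D \<in> sets (generated M x (J \<union> L))"
          using sets_generated_mono[of J "J \<union> L" M x] by (auto simp: G_def)
        then have [measurable]: "D \<in> sets M" using sub[of "J \<union> L"] by (auto simp: subalgebra_def)
        have "(\<integral>\<omega>. indicator D \<omega> * U \<omega> \<partial>M)
          = (\<integral>\<omega>. indicator D \<omega> * cos (Y \<omega> + c) - \<kappa> * (indicator D \<omega> * g \<omega>) \<partial>M)"
          by (simp add: U_def right_diff_distrib mult_ac)
        also have "\<dots> = 0"
          using cos_ind[OF D] b1 by (simp add: bd)
        finally show "(\<integral>\<omega>. indicator D \<omega> * U \<omega> \<partial>M) = 0" .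
      qed
      moreover have "(\<lambda>\<omega>. (indicator C \<omega> * h \<omega>) * U \<omega>)
          = (\<lambda>\<omega>. cos (Y \<omega> + c) * (indicator C \<omega> * h \<omega>) - \<kappa> * ((indicator C \<omega> * g \<omega>) * h \<omega>))"
        by (auto simp: U_def algebra_simps)
      moreover have i1: "integrable M (\<lambda>\<omega>. cos (Y \<omega> + c) * (indicator C \<omega> * h \<omega>))"
        using h by (intro bd) (auto simp: indicator_def)
      moreover have i2: "integrable M (\<lambda>\<omega>. (indicator C \<omega> * g \<omega>) * h \<omega>)"
        using h by (intro bd) (auto simp: indicator_def g_def)
      ultimately have "(\<integral>\<omega>. cos (Y \<omega> + c) * (indicator C \<omega> * h \<omega>) \<partial>M)
          = \<kappa> * (\<integral>\<omega>. (indicator C \<omega> * g \<omega>) * h \<omega> \<partial>M)"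
        by simp
      also have "(\<integral>\<omega>. (indicator C \<omega> * g \<omega>) * h \<omega> \<partial>M) = (\<integral>\<omega>. (indicator C \<omega> * g \<omega>) * indicator B \<omega> \<partial>M)"
        unfolding h_def
      proof (rule G.real_cond_exp_intg(2))
        show "integrable M (\<lambda>\<omega>. (indicator C \<omega> * g \<omega>) * indicator B \<omega>)"
          using int_ind(2) by (rule bd) (auto simp: indicator_def g_def)
        show "(\<lambda>\<omega>. indicator C \<omega> * g \<omega>) \<in> borel_measurable G"
          using g_G by measurable
      qed simp
      also have "\<kappa> * \<dots> = \<kappa> * (\<integral>\<omega>. indicator (C \<inter> B) \<omega> * g \<omega> \<partial>M)"
        by (simp add: indicator_inter_arith mult_ac)
      \<comment> \<open>\<open>C \<inter> B\<close> is an event of \<open>J \<union> L\<close>, so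
        the cosine formula applies to it and is read backwards.\<close>
      also have "\<dots> = (\<integral>\<omega>. indicator (C \<inter> B) \<omega> * cos (Y \<omega> + c) \<partial>M)"
        using B C sets_generated_mono[of J "J \<union> L" M x] sets_generated_mono[of L "J \<union> L" M x]
        by (intro cos_ind[symmetric]) (auto simp: G_def)
      finally have eq: "(\<integral>\<omega>. cos (Y \<omega> + c) * (indicator C \<omega> * h \<omega>) \<partial>M)
          = (\<integral>\<omega>. indicator (C \<inter> B) \<omega> * cos (Y \<omega> + c) \<partial>M)" .
      have "(\<integral>\<omega>. cos (Y \<omega> + c) * V \<omega> \<partial>M)
        = (\<integral>\<omega>. indicator (C \<inter> B) \<omega> * cos (Y \<omega> + c) - cos (Y \<omega> + c) * (indicator C \<omega> * h \<omega>) \<partial>M)"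
        by (intro Bochner_Integration.integral_cong)
           (auto simp: V_def indicator_inter_arith algebra_simps)
      also have "\<dots> = 0"
        using eq i1 b1 by (simp add: bd)
      finally show "(\<integral>\<omega>. cos ((\<Sum>k\<in>K. a k \<bullet> x k \<omega>) + c) * V \<omega> \<partial>M) = 0"
        by (simp add: Y_def)
    qed (use x in auto)
    moreover have "(\<lambda>\<omega>. indicator A \<omega> * V \<omega>)
        = (\<lambda>\<omega>. indicator C \<omega> * indicator (A \<inter> B) \<omega> - (indicator C \<omega> * h \<omega>) * indicator A \<omega>)"
      by (auto simp: V_def indicator_inter_arith algebra_simps)
    moreover have i3: "integrable M (\<lambda>\<omega>. (indicator C \<omega> * h \<omega>) * indicator A \<omega>)"
      using bd[OF hA1, of "indicator C"] by (simp add: mult_ac indicator_def)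
    moreover have "integrable M (\<lambda>\<omega>. indicator C \<omega> * indicator (A \<inter> B) \<omega> :: real)"
      by (intro ibd) (simp_all add: emeasure_eq_measure)
    ultimately have "(\<integral>\<omega>. indicator C \<omega> * indicator (A \<inter> B) \<omega> \<partial>M)
        = (\<integral>\<omega>. (indicator C \<omega> * h \<omega>) * indicator A \<omega> \<partial>M)"
      by simp
    \<comment> \<open>The weight \<open>indicator C * h\<close> is \<open>G\<close>-measurable,
      which permits replacing \<open>indicator A\<close> by its conditional expectation.\<close>
    also have "\<dots> = (\<integral>\<omega>. (indicator C \<omega> * h \<omega>) * hA \<omega> \<partial>M)"
      unfolding hA_def using h_G by (intro G.real_cond_exp_intg(2)[symmetric] i3) auto
    finally show "(\<integral>\<omega>\<in>C. indicator (A \<inter> B) \<omega> \<partial>M) = (\<integral>\<omega>\<in>C. hA \<omega> * h \<omega> \<partial>M)"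
      by (simp add: set_lebesgue_integral_def mult_ac)
  qed (use hhA h_G in \<open>auto simp: emeasure_eq_measure mult.commute\<close>)
  then show "AE \<omega> in M. real_cond_exp M (generated M x J) (indicator (A \<inter> B)) \<omega> =
      real_cond_exp M (generated M x J) (indicator A) \<omega> * real_cond_exp M (generated M x J) (indicator B) \<omega>"
    by (simp add: hA_def h_def G_def)
qed

text \<open>The centred residual has conditional expectation zero given \<open>J\<close>.
  Conditional independence allows an event of \<open>L\<close> to be replaced by its conditional
  probability given \<open>J\<close> in integrals against the residual, so the centred residual
  integrates to zero over events of \<open>L\<close> too. It is then orthogonal to the
  \<open>L\<close>-measurable functional \<open>b \<bullet> x i\<close>.\<close>

lemma covariance_residual_eq_0_if_cond_indep:
  fixes x :: "nat \<Rightarrow> 'a \<Rightarrow> real^'d"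
  assumes fin: "finite J"
    and x: "\<And>m. m \<in> J \<union> K \<union> L \<Longrightarrow> x m \<in> borel_measurable M"
      "\<And>m b. m \<in> J \<union> K \<union> L \<Longrightarrow> (\<lambda>\<omega>. b \<bullet> x m \<omega>) \<in> H"
    and indep: "cond_indep M (generated M x J) (generated M x K) (generated M x L)"
    and k: "k \<in> K" and i: "i \<in> L"
    and R_def: "R = (\<lambda>\<omega>. a \<bullet> x k \<omega> - (\<Sum>m\<in>J. w m \<bullet> x m \<omega>))"
    and uR: "\<And>m b. m \<in> J \<Longrightarrow> covariance M R (\<lambda>\<omega>. b \<bullet> x m \<omega>) = 0"
  shows "covariance M R (\<lambda>\<omega>. b \<bullet> x i \<omega>) = 0"
proof -
  define G where "G = generated M x J"
  have sub: "subalgebra M (generated M x S)" if "S \<subseteq> J \<union> K \<union> L" for S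
    using x(1) that by (intro subalgebra_generated) auto
  interpret G: finite_measure_subalgebra M G
    using sub[of J] by unfold_locales (auto simp: G_def)
  interpret K: finite_measure_subalgebra M "generated M x K"
    using sub[of K] by unfold_locales auto
  interpret L: finite_measure_subalgebra M "generated M x L"
    using sub[of L] by unfold_locales auto
  define u where "u \<omega> = a \<bullet> x k \<omega>" for \<omega>
  define p where "p \<omega> = (\<Sum>m\<in>J. w m \<bullet> x m \<omega>)" for \<omega>
  define v where "v \<omega> = b \<bullet> x i \<omega>" for \<omega>
  have H: "u \<in> H" "p \<in> H" "v \<in> H"
    unfolding u_def p_def v_def using x(2) k i by (auto intro!: sum)
  have Rup: "R = (\<lambda>\<omega>. u \<omega> - p \<omega>)" by (auto simp: R_def u_def p_def)
  have R: "R \<in> H" unfolding Rup using H by auto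
  have p_G: "p \<in> borel_measurable G" unfolding p_def G_def
    by (intro borel_measurable_sum borel_measurable_inner borel_measurable_const measurable_generated)
  have u_K: "u \<in> borel_measurable (generated M x K)" unfolding u_def
    by (intro borel_measurable_inner borel_measurable_const measurable_generated k)
  have v_L: "v \<in> borel_measurable (generated M x L)" unfolding v_def
    by (intro borel_measurable_inner borel_measurable_const measurable_generated i)
  have [measurable]: "R \<in> borel_measurable M" "u \<in> borel_measurable M" "p \<in> borel_measurable M"
    "v \<in> borel_measurable M"
    using R H measurable_H by auto
  have bd: "integrable M (\<lambda>\<omega>. f \<omega> * g \<omega>)"
    if "integrable M g" "f \<in> borel_measurable M" "\<And>\<omega>. \<bar>f \<omega>\<bar> \<le> 1" for f g :: "'a \<Rightarrow> real"
    using that by (rule integrable_mult_bounded)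
  have ibd: "integrable M (\<lambda>\<omega>. indicator C \<omega> * g \<omega>)"
    if "integrable M g" "C \<in> sets M" for g :: "'a \<Rightarrow> real" and C
    using that by (intro bd) (auto simp: indicator_def)
  define R0 where "R0 \<omega> = R \<omega> - expectation R" for \<omega>
  have R0: "integrable M R0" unfolding R0_def using integrable_H[OF R] by simp
  have G0: "(\<integral>\<omega>. indicator C \<omega> * R0 \<omega> \<partial>M) = 0" if C: "C \<in> sets G" for C
  proof -
    have [measurable]: "C \<in> sets M" using C G.subalg by (auto simp: subalgebra_def)
    have intC: "integrable M (indicator C :: 'a \<Rightarrow> real)" by (simp add: emeasure_eq_measure)
    \<comment> \<open>With the centred indicator, orthogonality of \<open>R\<close> and
      \<open>V\<close> says that the integral of \<open>R\<close> over \<open>C\<close> is its mean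
      times \<open>prob C\<close>. It is enough to test \<open>V\<close> against cosines of
      \<open>R\<close>, where \<open>integral_indicator_cos_add\<close> applies with
      \<open>Z\<close> zero.\<close>
    define V where "V \<omega> = indicator C \<omega> - prob C" for \<omega>
    have V: "integrable M V" unfolding V_def using intC by simp
    have "(\<integral>\<omega>. R \<omega> * V \<omega> \<partial>M) = 0"
    proof (rule integral_mult_self_eq_0[OF _ V])
      fix t c
      have tR: "(\<lambda>\<omega>. t * R \<omega>) \<in> H" using R by auto
      have cos_ind: "(\<integral>\<omega>. indicator D \<omega> * cos (t * R \<omega> + 0 + c) \<partial>M)
        = exp (- covariance M (\<lambda>\<omega>. t * R \<omega>) (\<lambda>\<omega>. t * R \<omega>) / 2)
          * (\<integral>\<omega>. indicator D \<omega> * cos (expectation (\<lambda>\<omega>. t * R \<omega>) + 0 + c) \<partial>M)"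
        if "D \<in> sets G" for D
      proof (rule integral_indicator_cos_add[OF fin _ _ tR zero _ _ that[unfolded G_def]])
        fix m b assume "m \<in> J"
        then show "covariance M (\<lambda>\<omega>. t * R \<omega>) (\<lambda>\<omega>. b \<bullet> x m \<omega>) = 0"
          using uR R x(2) by (simp add: covariance_cmult_left)
      next
        show "covariance M (\<lambda>\<omega>. t * R \<omega>) (\<lambda>_. 0) = 0" by (simp add: covariance_def)
      qed (use x in auto)
      have sp: "space M \<in> sets G" using G.subalg by (metis sets.top subalgebra_def)
      define e where "e = exp (- covariance M (\<lambda>\<omega>. t * R \<omega>) (\<lambda>\<omega>. t * R \<omega>) / 2)
        * cos (expectation (\<lambda>\<omega>. t * R \<omega>) + c)"
      have 1: "(\<integral>\<omega>. indicator D \<omega> * cos (t * R \<omega> + c) \<partial>M) = e * prob D" if "D \<in> sets G" for D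
      proof -
        have [measurable]: "D \<in> sets M" using that G.subalg by (auto simp: subalgebra_def)
        then show ?thesis using cos_ind[OF that] by (simp add: e_def sets.Int_space_eq2)
      qed
      have "(\<integral>\<omega>. cos (t * R \<omega> + c) \<partial>M) = (\<integral>\<omega>. indicator (space M) \<omega> * cos (t * R \<omega> + c) \<partial>M)"
        by (intro Bochner_Integration.integral_cong) auto
      also have "\<dots> = e" using 1[OF sp] by (simp add: prob_space)
      finally have 2: "(\<integral>\<omega>. cos (t * R \<omega> + c) \<partial>M) = e" .
      have ic: "integrable M (\<lambda>\<omega>. cos (t * R \<omega> + c))"
        by (intro integrable_const_bound[where B = 1]) auto
      have "(\<integral>\<omega>. cos (t * R \<omega> + c) * V \<omega> \<partial>M)
          = (\<integral>\<omega>. indicator C \<omega> * cos (t * R \<omega> + c) - prob C * cos (t * R \<omega> + c) \<partial>M)"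
        by (intro Bochner_Integration.integral_cong) (auto simp: V_def algebra_simps)
      also have "\<dots> = 0" using 1[OF C] 2 ic by (simp add: bd)
      finally show "(\<integral>\<omega>. cos (t * R \<omega> + c) * V \<omega> \<partial>M) = 0" .
    next
      have "\<bar>V \<omega>\<bar> \<le> 1" for \<omega> by (auto simp: V_def indicator_def)
      then have "integrable M (\<lambda>\<omega>. V \<omega> * R \<omega>)"
        using integrable_H[OF R] V by (intro bd) auto
      then show "integrable M (\<lambda>\<omega>. R \<omega> * V \<omega>)" by (simp add: mult.commute)
    qed auto
    moreover have "(\<lambda>\<omega>. R \<omega> * V \<omega>) = (\<lambda>\<omega>. indicator C \<omega> * R \<omega> - prob C * R \<omega>)"
      by (auto simp: V_def algebra_simps)
    moreover have "integrable M (\<lambda>\<omega>. indicator C \<omega> * R \<omega>)"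
      using integrable_H[OF R] by (intro bd) (auto simp: indicator_def)
    ultimately show ?thesis
      using integrable_H[OF R] intC by (simp add: R0_def right_diff_distrib sets.Int_space_eq2)
  qed
  have L0: "(\<integral>\<omega>. indicator D \<omega> * R0 \<omega> \<partial>M) = 0" if D: "D \<in> sets (generated M x L)" for D
  proof -
    have [measurable]: "D \<in> sets M" using D L.subalg by (auto simp: subalgebra_def)
    have intD: "integrable M (indicator D :: 'a \<Rightarrow> real)" by (simp add: emeasure_eq_measure)
    define h where "h = real_cond_exp M G (indicator D)"
    have [measurable]: "h \<in> borel_measurable M" by (simp add: h_def)
    have h_G: "h \<in> borel_measurable G" by (simp add: h_def)
    have h: "integrable M h" unfolding h_def using intD by (intro G.real_cond_exp_int)
    \<comment> \<open>The bound on \<open>h\<close> holds only almost everywhere, so integrability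
      of products with \<open>h\<close> is derived separately from \<open>bd\<close>.\<close>
    have "AE \<omega> in M. 0 \<le> h \<omega>" "AE \<omega> in M. h \<omega> \<le> 1"
      unfolding h_def using intD
      by (auto intro!: G.real_cond_exp_ge_c G.real_cond_exp_le_c simp: indicator_def)
    then have h1: "AE \<omega> in M. \<bar>h \<omega>\<bar> \<le> 1" by eventually_elim auto
    have ih: "integrable M (\<lambda>\<omega>. f \<omega> * h \<omega>)" if f: "integrable M f" for f :: "'a \<Rightarrow> real"
    proof (rule Bochner_Integration.integrable_bound[OF f])
      show "AE \<omega> in M. norm (f \<omega> * h \<omega>) \<le> norm (f \<omega>)"
        using h1 by eventually_elim (simp add: abs_mult mult_left_le)
    qed (use f in auto)
    have iD: "integrable M (\<lambda>\<omega>. f \<omega> * indicator D \<omega>)" if f: "integrable M f" for f :: "'a \<Rightarrow> real"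
      using bd[OF f, of "indicator D"] by (simp add: mult.commute indicator_def)
    \<comment> \<open>Conditional independence shows that \<open>indicator D - h\<close> integrates
      to zero over events of \<open>K\<close>; this extends to the unbounded
      \<open>K\<close>-measurable factor \<open>u\<close>.\<close>
    have "(\<integral>\<omega>. u \<omega> * (indicator D \<omega> - h \<omega>) \<partial>M) = 0"
    proof (rule K.integral_mult_eq_0[OF _ _ u_K])
      show "integrable M (\<lambda>\<omega>. indicator D \<omega> - h \<omega>)" using intD h by simp
      show "integrable M (\<lambda>\<omega>. u \<omega> * (indicator D \<omega> - h \<omega>))"
        using ih iD integrable_H[OF H(1)] by (simp add: right_diff_distrib)
      fix A assume A: "A \<in> sets (generated M x K)"
      then have [measurable]: "A \<in> sets M" using K.subalg by (auto simp: subalgebra_def)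
      have intA: "integrable M (indicator A :: 'a \<Rightarrow> real)" by (simp add: emeasure_eq_measure)
      have iA: "integrable M (\<lambda>\<omega>. h \<omega> * indicator A \<omega>)" using ih[OF intA] by (simp add: mult.commute)
      have "(\<integral>\<omega>. indicator A \<omega> * indicator D \<omega> \<partial>M) = (\<integral>\<omega>. indicator (A \<inter> D) \<omega> \<partial>M :: real)"
        by (simp add: indicator_inter_arith)
      also have "\<dots> = (\<integral>\<omega>. real_cond_exp M G (indicator (A \<inter> D)) \<omega> \<partial>M)"
        by (intro G.real_cond_exp_int(2)[symmetric]) (simp add: emeasure_eq_measure)
      also have "\<dots> = (\<integral>\<omega>. h \<omega> * real_cond_exp M G (indicator A) \<omega> \<partial>M)"
        using indep A D by (intro integral_cong_AE) (auto simp: cond_indep_def G_def h_def mult.commute)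
      also have "\<dots> = (\<integral>\<omega>. h \<omega> * indicator A \<omega> \<partial>M)"
        using h_G iA by (intro G.real_cond_exp_intg) auto
      finally show "(\<integral>\<omega>. indicator A \<omega> * (indicator D \<omega> - h \<omega>) \<partial>M) = 0"
        using iA iD[OF intA] by (simp add: right_diff_distrib mult.commute)
    qed
    then have 1: "(\<integral>\<omega>. u \<omega> * indicator D \<omega> \<partial>M) = (\<integral>\<omega>. u \<omega> * h \<omega> \<partial>M)"
      using ih iD integrable_H[OF H(1)] by (simp add: right_diff_distrib)
    \<comment> \<open>For the \<open>G\<close>-measurable \<open>p\<close> this is the defining
      property of \<open>h\<close>.\<close>
    have 2: "(\<integral>\<omega>. p \<omega> * indicator D \<omega> \<partial>M) = (\<integral>\<omega>. p \<omega> * h \<omega> \<partial>M)"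
      unfolding h_def using p_G integrable_H[OF H(2)] iD
      by (intro G.real_cond_exp_intg(2)[symmetric]) auto
    have 3: "(\<integral>\<omega>. h \<omega> * R0 \<omega> \<partial>M) = 0"
      using ih[OF R0] by (intro G.integral_mult_eq_0[OF R0 G0 h_G]) (auto simp: mult.commute)
    have 4: "(\<integral>\<omega>. h \<omega> \<partial>M) = (\<integral>\<omega>. indicator D \<omega> \<partial>M)"
      unfolding h_def using intD by (intro G.real_cond_exp_int)
    have "(\<integral>\<omega>. indicator D \<omega> * R0 \<omega> \<partial>M)
        = (\<integral>\<omega>. u \<omega> * indicator D \<omega> - p \<omega> * indicator D \<omega> - expectation R * indicator D \<omega> \<partial>M)"
      by (intro Bochner_Integration.integral_cong) (auto simp: R0_def Rup algebra_simps)
    also have "\<dots> = (\<integral>\<omega>. u \<omega> * h \<omega> \<partial>M) - (\<integral>\<omega>. p \<omega> * h \<omega> \<partial>M) - expectation R * (\<integral>\<omega>. h \<omega> \<partial>M)"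
      using iD integrable_H[OF H(1)] integrable_H[OF H(2)] intD 1 2 4 by simp
    also have "\<dots> = (\<integral>\<omega>. u \<omega> * h \<omega> - p \<omega> * h \<omega> - expectation R * h \<omega> \<partial>M)"
      using ih integrable_H[OF H(1)] integrable_H[OF H(2)] h by simp
    also have "\<dots> = (\<integral>\<omega>. h \<omega> * R0 \<omega> \<partial>M)"
      by (intro Bochner_Integration.integral_cong) (auto simp: R0_def Rup algebra_simps)
    finally show ?thesis using 3 by simp
  qed
  have int: "integrable M (\<lambda>\<omega>. v \<omega> * R0 \<omega>)"
    using integrable_mult_H[OF R H(3)] integrable_H[OF H(3)]
    by (simp add: R0_def right_diff_distrib mult.commute)
  have "(\<integral>\<omega>. v \<omega> * R0 \<omega> \<partial>M) = 0"
    by (rule L.integral_mult_eq_0[OF R0 L0 v_L int])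
  moreover have "(\<lambda>\<omega>. v \<omega> * R0 \<omega>) = (\<lambda>\<omega>. R \<omega> * v \<omega> - expectation R * v \<omega>)"
    by (auto simp: R0_def algebra_simps)
  ultimately have "covariance M R v = 0"
    using integrable_mult_H[OF R H(3)] integrable_H[OF H(3)] by (simp add: covariance_eq[OF R H(3)])
  then show ?thesis by (simp add: v_def[abs_def])
qed

end

section \<open>The covariance equation\<close>

text \<open>Row and column types may differ, so that a stacked pair can stand on either side and
  each block matrix of \<open>cov_eq\<close> becomes a single instance.\<close>

definition cross_cov :: "'a measure \<Rightarrow> ('a \<Rightarrow> real^'m) \<Rightarrow> ('a \<Rightarrow> real^'n) \<Rightarrow> real^'n^'m" where
  "cross_cov M u v = (\<chi> a b. covariance M (\<lambda>\<omega>. u \<omega> $ a) (\<lambda>\<omega>. v \<omega> $ b))"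

definition stack :: "real^'m \<Rightarrow> real^'n \<Rightarrow> real^('m + 'n)" where
  "stack p q = (\<chi> c. case c of Inl c \<Rightarrow> p $ c | Inr c \<Rightarrow> q $ c)"

lemma stack_nth [simp]: "stack p q $ Inl a = p $ a" "stack p q $ Inr b = q $ b"
  by (simp_all add: stack_def)

lemma inner_stack: "stack a b \<bullet> stack p q = a \<bullet> p + b \<bullet> q"
  unfolding inner_vec_def by (subst UNIV_Plus_UNIV[symmetric], subst sum.Plus) simp_all

lemma stack_cases: obtains p q where "w = stack p q"
proof
  show "w = stack (\<chi> a. w $ Inl a) (\<chi> b. w $ Inr b)"
    by (auto simp: vec_eq_iff stack_def split: sum.split)
qed

context gaussian_space
begin

lemma inner_H: "(\<And>a. (\<lambda>\<omega>. u \<omega> $ a) \<in> H) \<Longrightarrow> (\<lambda>\<omega>. c \<bullet> u \<omega>) \<in> H"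
  unfolding inner_vec_def by (simp add: sum cmult)

lemma covariance_inner_inner:
  assumes u: "\<And>a. (\<lambda>\<omega>. u \<omega> $ a) \<in> H" and v: "\<And>a. (\<lambda>\<omega>. v \<omega> $ a) \<in> H"
  shows "covariance M (\<lambda>\<omega>. a \<bullet> u \<omega>) (\<lambda>\<omega>. b \<bullet> v \<omega>) = a \<bullet> (cross_cov M u v *v b)"
proof -
  have "covariance M (\<lambda>\<omega>. a \<bullet> u \<omega>) (\<lambda>\<omega>. b \<bullet> v \<omega>)
      = (\<Sum>p\<in>UNIV. a $ p * covariance M (\<lambda>\<omega>. u \<omega> $ p) (\<lambda>\<omega>. b \<bullet> v \<omega>))"
    unfolding inner_vec_def[of a] using u inner_H[OF v]
    by (subst covariance_sum_left) (auto simp: covariance_cmult_left cmult)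
  also have "\<dots> = (\<Sum>p\<in>UNIV. a $ p * (\<Sum>q\<in>UNIV. b $ q * covariance M (\<lambda>\<omega>. v \<omega> $ q) (\<lambda>\<omega>. u \<omega> $ p)))"
  proof -
    have "covariance M (\<lambda>\<omega>. u \<omega> $ p) (\<lambda>\<omega>. b \<bullet> v \<omega>)
        = (\<Sum>q\<in>UNIV. b $ q * covariance M (\<lambda>\<omega>. v \<omega> $ q) (\<lambda>\<omega>. u \<omega> $ p))" for p
      unfolding inner_vec_def[of b] using u v
      by (subst covariance_commute, subst covariance_sum_left) (auto simp: covariance_cmult_left cmult)
    then show ?thesis by simp
  qed
  finally show ?thesis
    by (simp add: inner_vec_def matrix_vector_mult_def cross_cov_def covariance_commute mult.commute)
qed

text \<open>For singular covariance the regression weights are not unique, but two choices differ by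
  a functional of \<open>z\<close> with zero variance, which no covariance detects.\<close>

lemma residual_unique:
  assumes u: "\<And>a. (\<lambda>\<omega>. u \<omega> $ a) \<in> H" and z: "\<And>a. (\<lambda>\<omega>. z \<omega> $ a) \<in> H" and f: "f \<in> H"
    and w: "\<And>b. covariance M (\<lambda>\<omega>. a \<bullet> u \<omega> - w \<bullet> z \<omega>) (\<lambda>\<omega>. b \<bullet> z \<omega>) = 0"
    and w': "\<And>b. covariance M (\<lambda>\<omega>. a \<bullet> u \<omega> - w' \<bullet> z \<omega>) (\<lambda>\<omega>. b \<bullet> z \<omega>) = 0"
  shows "covariance M (\<lambda>\<omega>. a \<bullet> u \<omega> - w \<bullet> z \<omega>) f = covariance M (\<lambda>\<omega>. a \<bullet> u \<omega> - w' \<bullet> z \<omega>) f"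
proof -
  note H = inner_H[OF u] inner_H[OF z]
  have d: "(\<lambda>\<omega>. (w' - w) \<bullet> z \<omega>) = (\<lambda>\<omega>. (a \<bullet> u \<omega> - w \<bullet> z \<omega>) - (a \<bullet> u \<omega> - w' \<bullet> z \<omega>))"
    by (auto simp: inner_diff_left)
  have "covariance M (\<lambda>\<omega>. (w' - w) \<bullet> z \<omega>) (\<lambda>\<omega>. (w' - w) \<bullet> z \<omega>) = 0"
    using w[of "w' - w"] w'[of "w' - w"] H
    by (subst d) (subst covariance_diff_left, simp_all add: diff)
  then have "covariance M (\<lambda>\<omega>. (w' - w) \<bullet> z \<omega>) f = 0"
    by (rule covariance_self_eq_0D[OF H(2)])
  then show ?thesis
    unfolding d using H f by (subst (asm) covariance_diff_left) (auto simp: diff)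
qed

text \<open>If \<open>y\<close> is in the kernel of the covariance of \<open>z\<close>, then
  \<open>y \<bullet> z\<close> has zero variance, so \<open>y\<close> is also in the kernel of the
  cross-covariance with \<open>u\<close>. For the Moore-Penrose weights this is the normal equation
  of linear regression.\<close>

lemma cross_cov_pinv_mult:
  assumes u: "\<And>a. (\<lambda>\<omega>. u \<omega> $ a) \<in> H" and z: "\<And>a. (\<lambda>\<omega>. z \<omega> $ a) \<in> H"
  shows "cross_cov M u z ** moore_penrose (cross_cov M z z) ** cross_cov M z z = cross_cov M u z"
proof -
  define S where "S = cross_cov M z z"
  have S: "S ** moore_penrose S ** S = S"
    using is_moore_penrose_moore_penrose[of S] by (simp add: is_moore_penrose_def)
  have ker: "cross_cov M u z *v y = 0" if "S *v y = 0" for y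
  proof -
    have "covariance M (\<lambda>\<omega>. y \<bullet> z \<omega>) (\<lambda>\<omega>. y \<bullet> z \<omega>) = 0"
      using covariance_inner_inner[OF z z, of y y] that by (simp add: S_def)
    then have "covariance M (\<lambda>\<omega>. y \<bullet> z \<omega>) (\<lambda>\<omega>. a \<bullet> u \<omega>) = 0" for a
      by (rule covariance_self_eq_0D[OF inner_H[OF z]])
    then have "a \<bullet> (cross_cov M u z *v y) = 0" for a
      using covariance_inner_inner[OF u z, of a y] by (simp add: covariance_commute)
    then show ?thesis using inner_eq_zero_iff by blast
  qed
  have "(cross_cov M u z ** moore_penrose S ** S) *v y = cross_cov M u z *v y" for y
  proof -
    \<comment> \<open>The vector \<open>moore_penrose S *v (S *v y) - y\<close> is in the kernel of
      \<open>S\<close>, so the kernel inclusion applies to it.\<close>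
    have "S *v (moore_penrose S *v (S *v y) - y) = (S ** moore_penrose S ** S) *v y - S *v y"
      by (simp add: matrix_vector_mult_diff_distrib matrix_vector_mul_assoc matrix_mul_assoc)
    then have "S *v (moore_penrose S *v (S *v y) - y) = 0" by (simp add: S)
    then show ?thesis
      using ker[of "moore_penrose S *v (S *v y) - y"]
      by (simp add: matrix_vector_mult_diff_distrib matrix_vector_mul_assoc matrix_mul_assoc)
  qed
  then show ?thesis by (simp add: matrix_eq S_def)
qed

text \<open>The matrix on the right is the generalized Schur complement; by bilinearity it is the
  cross-covariance of \<open>v\<close> with the residual formed with Moore-Penrose weights.\<close>

lemma residual_pinv:
  assumes u: "\<And>a. (\<lambda>\<omega>. u \<omega> $ a) \<in> H" and z: "\<And>a. (\<lambda>\<omega>. z \<omega> $ a) \<in> H" and v: "\<And>a. (\<lambda>\<omega>. v \<omega> $ a) \<in> H"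
  shows "covariance M (\<lambda>\<omega>. a \<bullet> u \<omega> - (a v* (cross_cov M u z ** moore_penrose (cross_cov M z z))) \<bullet> z \<omega>)
      (\<lambda>\<omega>. b \<bullet> v \<omega>)
    = a \<bullet> ((cross_cov M u v - cross_cov M u z ** moore_penrose (cross_cov M z z) ** cross_cov M z v) *v b)"
proof -
  let ?W = "cross_cov M u z ** moore_penrose (cross_cov M z z)"
  have "covariance M (\<lambda>\<omega>. a \<bullet> u \<omega> - (a v* ?W) \<bullet> z \<omega>) (\<lambda>\<omega>. b \<bullet> v \<omega>)
      = a \<bullet> (cross_cov M u v *v b) - (a v* ?W) \<bullet> (cross_cov M z v *v b)"
    unfolding covariance_inner_inner[OF u v, symmetric] covariance_inner_inner[OF z v, symmetric]
    by (intro covariance_diff_left inner_H u v z)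
  then show ?thesis
    by (simp add: dot_lmul_matrix matrix_vector_mult_diff_rdistrib inner_diff_right matrix_vector_mul_assoc)
qed

lemma residual_exists:
  assumes u: "\<And>a. (\<lambda>\<omega>. u \<omega> $ a) \<in> H" and z: "\<And>a. (\<lambda>\<omega>. z \<omega> $ a) \<in> H"
  shows "\<exists>w. \<forall>b. covariance M (\<lambda>\<omega>. a \<bullet> u \<omega> - w \<bullet> z \<omega>) (\<lambda>\<omega>. b \<bullet> z \<omega>) = 0"
  using residual_pinv[OF u z z] by (auto simp: cross_cov_pinv_mult[OF u z])

text \<open>The equation says that the Schur complement \<open>D\<close> vanishes, that is, that the
  Moore-Penrose residual is uncorrelated with \<open>v\<close>. Existential weights suffice on the
  right because, by \<open>residual_unique\<close>, all admissible weights give the same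
  covariances.\<close>

lemma cross_cov_eq_iff:
  assumes u: "\<And>a. (\<lambda>\<omega>. u \<omega> $ a) \<in> H" and z: "\<And>a. (\<lambda>\<omega>. z \<omega> $ a) \<in> H" and v: "\<And>a. (\<lambda>\<omega>. v \<omega> $ a) \<in> H"
  shows "cross_cov M u v = cross_cov M u z ** moore_penrose (cross_cov M z z) ** cross_cov M z v \<longleftrightarrow>
    (\<forall>a. \<exists>w. (\<forall>b. covariance M (\<lambda>\<omega>. a \<bullet> u \<omega> - w \<bullet> z \<omega>) (\<lambda>\<omega>. b \<bullet> z \<omega>) = 0) \<and>
      (\<forall>b. covariance M (\<lambda>\<omega>. a \<bullet> u \<omega> - w \<bullet> z \<omega>) (\<lambda>\<omega>. b \<bullet> v \<omega>) = 0))"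
    (is "?eq \<longleftrightarrow> ?res")
proof -
  define W where "W a = a v* (cross_cov M u z ** moore_penrose (cross_cov M z z))" for a
  define D where "D = cross_cov M u v - cross_cov M u z ** moore_penrose (cross_cov M z z) ** cross_cov M z v"
  have Wz: "covariance M (\<lambda>\<omega>. a \<bullet> u \<omega> - W a \<bullet> z \<omega>) (\<lambda>\<omega>. b \<bullet> z \<omega>) = 0" for a b
    unfolding W_def residual_pinv[OF u z z] by (simp add: cross_cov_pinv_mult[OF u z])
  have Wv: "covariance M (\<lambda>\<omega>. a \<bullet> u \<omega> - W a \<bullet> z \<omega>) (\<lambda>\<omega>. b \<bullet> v \<omega>) = a \<bullet> (D *v b)" for a b
    unfolding W_def D_def by (rule residual_pinv[OF u z v])
  show ?thesis
  proof
    assume ?eq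
    then have "D = 0" by (simp add: D_def)
    then have "covariance M (\<lambda>\<omega>. a \<bullet> u \<omega> - W a \<bullet> z \<omega>) (\<lambda>\<omega>. b \<bullet> v \<omega>) = 0" for a b
      by (simp add: Wv)
    with Wz show ?res by blast
  next
    assume res: ?res
    have "a \<bullet> (D *v b) = 0" for a b
    proof -
      obtain w where w: "\<And>b. covariance M (\<lambda>\<omega>. a \<bullet> u \<omega> - w \<bullet> z \<omega>) (\<lambda>\<omega>. b \<bullet> z \<omega>) = 0"
        "\<And>b. covariance M (\<lambda>\<omega>. a \<bullet> u \<omega> - w \<bullet> z \<omega>) (\<lambda>\<omega>. b \<bullet> v \<omega>) = 0"
        using res by blast
      show ?thesis
        using residual_unique[OF u z inner_H[OF v] Wz w(1), of b] w(2)[of b] by (simp add: Wv)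
    qed
    then have "D *v b = 0" for b using inner_eq_zero_iff by blast
    then have "D = 0" by (simp add: matrix_eq)
    then show ?eq by (simp add: D_def)
  qed
qed

end

section \<open>Regression on the states at two times, and the calculus of the covariance
  equation\<close>

locale gaussian_process = gaussian_space M H
  for M :: "'a measure" and H +
  fixes x :: "nat \<Rightarrow> 'a \<Rightarrow> real^'d" and N :: nat
  assumes x_measurable: "k \<le> N \<Longrightarrow> x k \<in> borel_measurable M"
    and x_nth: "k \<le> N \<Longrightarrow> (\<lambda>\<omega>. x k \<omega> $ c) \<in> H"
begin

definition residual :: "nat \<Rightarrow> nat \<Rightarrow> nat \<Rightarrow> real^'d \<Rightarrow> real^'d \<Rightarrow> real^'d \<Rightarrow> 'a \<Rightarrow> real" where
  "residual j l k a p q = (\<lambda>\<omega>. a \<bullet> x k \<omega> - (p \<bullet> x j \<omega> + q \<bullet> x l \<omega>))"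

definition is_residual :: "nat \<Rightarrow> nat \<Rightarrow> nat \<Rightarrow> real^'d \<Rightarrow> real^'d \<Rightarrow> real^'d \<Rightarrow> bool" where
  "is_residual j l k a p q \<longleftrightarrow>
    (\<forall>m\<in>{j, l}. \<forall>b. covariance M (residual j l k a p q) (\<lambda>\<omega>. b \<bullet> x m \<omega>) = 0)"

lemma x_H: "k \<le> N \<Longrightarrow> (\<lambda>\<omega>. a \<bullet> x k \<omega>) \<in> H"
  by (intro inner_H x_nth)

lemma residual_H: "j \<le> N \<Longrightarrow> l \<le> N \<Longrightarrow> k \<le> N \<Longrightarrow> residual j l k a p q \<in> H"
  unfolding residual_def by (intro diff add x_H)

lemma stack_H: "j \<le> N \<Longrightarrow> l \<le> N \<Longrightarrow> (\<lambda>\<omega>. stack (x j \<omega>) (x l \<omega>) $ c) \<in> H"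
  by (cases c) (auto simp: x_nth)

lemma residual_stack:
  "residual j l k a p q = (\<lambda>\<omega>. a \<bullet> x k \<omega> - stack p q \<bullet> stack (x j \<omega>) (x l \<omega>))"
  by (simp add: residual_def inner_stack)

lemma is_residual_stack:
  assumes "j \<le> N" "l \<le> N" "k \<le> N"
  shows "is_residual j l k a p q \<longleftrightarrow>
    (\<forall>b. covariance M (residual j l k a p q) (\<lambda>\<omega>. b \<bullet> stack (x j \<omega>) (x l \<omega>)) = 0)"
    (is "_ \<longleftrightarrow> (\<forall>b. ?c b = 0)")
proof -
  have c: "?c (stack b c) = covariance M (residual j l k a p q) (\<lambda>\<omega>. b \<bullet> x j \<omega>)
      + covariance M (residual j l k a p q) (\<lambda>\<omega>. c \<bullet> x l \<omega>)" for b c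
    using assms by (simp add: inner_stack covariance_add_right x_H residual_H)
  have z: "covariance M (residual j l k a p q) (\<lambda>_. 0) = 0"
    by (simp add: covariance_def)
  show ?thesis
  proof
    assume r: "is_residual j l k a p q"
    show "\<forall>b. ?c b = 0"
    proof
      fix b :: "real^('d + 'd)"
      obtain b1 b2 where b: "b = stack b1 b2" by (rule stack_cases)
      show "?c b = 0" using r unfolding b c is_residual_def by simp
    qed
  next
    assume r: "\<forall>b. ?c b = 0"
    have "covariance M (residual j l k a p q) (\<lambda>\<omega>. b \<bullet> x j \<omega>) = 0" for b
      using c[of b 0] r z by simp
    moreover have "covariance M (residual j l k a p q) (\<lambda>\<omega>. b \<bullet> x l \<omega>) = 0" for b
      using c[of 0 b] r z by simp
    ultimately show "is_residual j l k a p q" by (simp add: is_residual_def)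
  qed
qed

lemma is_residual_exists:
  assumes "j \<le> N" "l \<le> N" "k \<le> N"
  obtains p q where "is_residual j l k a p q"
proof -
  obtain w where w: "\<And>b. covariance M (\<lambda>\<omega>. a \<bullet> x k \<omega> - w \<bullet> stack (x j \<omega>) (x l \<omega>))
      (\<lambda>\<omega>. b \<bullet> stack (x j \<omega>) (x l \<omega>)) = 0"
    using residual_exists[of "x k" "\<lambda>\<omega>. stack (x j \<omega>) (x l \<omega>)" a] x_nth stack_H assms by blast
  obtain p q where "w = stack p q" by (rule stack_cases)
  then show ?thesis
    using w by (intro that[of p q]) (simp add: is_residual_stack residual_stack assms)
qed

text \<open>Stacking the two conditioning states makes the blocks of \<open>cov_eq\<close>
  cross-covariances. From here on the matrix equation is handled only through uncorrelated
  residuals.\<close>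

lemma cov_eq_iff:
  assumes "i \<le> N" "j \<le> N" "k \<le> N" "l \<le> N"
  shows "cov_eq (cov M x) i j k l \<longleftrightarrow> (\<forall>a. \<exists>p q. is_residual j l k a p q \<and>
    (\<forall>b. covariance M (residual j l k a p q) (\<lambda>\<omega>. b \<bullet> x i \<omega>) = 0))"
proof -
  let ?z = "\<lambda>\<omega>. stack (x j \<omega>) (x l \<omega>)"
  have blocks: "block_row (cov M x k j) (cov M x k l) = cross_cov M (x k) ?z"
    "block_col (block_row (cov M x j j) (cov M x j l)) (block_row (cov M x l j) (cov M x l l))
      = cross_cov M ?z ?z"
    "block_col (cov M x j i) (cov M x l i) = cross_cov M ?z (x i)"
    "cov M x k i = cross_cov M (x k) (x i)"
    by (auto simp: vec_eq_iff block_row_def block_col_def cross_cov_def cov_def stack_def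
      split: sum.split)
  have ex: "(\<exists>w. P w) \<longleftrightarrow> (\<exists>p q. P (stack p q))" for P :: "real^('d + 'd) \<Rightarrow> bool"
    by (metis stack_cases)
  show ?thesis
    unfolding cov_eq_def blocks
    by (subst cross_cov_eq_iff)
       (simp_all add: x_nth stack_H assms ex is_residual_stack residual_stack)
qed

text \<open>\<open>cov_eq_iff\<close> provides some residual uncorrelated with \<open>x i\<close>;
  uniqueness up to zero variance transfers this to every residual.\<close>

lemma cov_eqD:
  assumes le: "i \<le> N" "j \<le> N" "k \<le> N" "l \<le> N"
    and eq: "cov_eq (cov M x) i j k l" and r: "is_residual j l k a p q"
  shows "covariance M (residual j l k a p q) (\<lambda>\<omega>. b \<bullet> x i \<omega>) = 0"
proof -
  obtain p' q' where r': "is_residual j l k a p' q'"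
    "covariance M (residual j l k a p' q') (\<lambda>\<omega>. b \<bullet> x i \<omega>) = 0"
    using eq unfolding cov_eq_iff[OF le] by blast
  show ?thesis
    using residual_unique[of "x k" "\<lambda>\<omega>. stack (x j \<omega>) (x l \<omega>)" "\<lambda>\<omega>. b \<bullet> x i \<omega>"
        a "stack p q" "stack p' q'"] r r' le
    by (simp add: is_residual_stack residual_stack x_nth stack_H x_H)
qed

lemma covariance_residual_left:
  assumes "j \<le> N" "l \<le> N" "k \<le> N" "f \<in> H"
  shows "covariance M (residual j l k a p q) f = covariance M (\<lambda>\<omega>. a \<bullet> x k \<omega>) f
    - (covariance M (\<lambda>\<omega>. p \<bullet> x j \<omega>) f + covariance M (\<lambda>\<omega>. q \<bullet> x l \<omega>) f)"
  unfolding residual_def using assms by (simp add: covariance_diff_left covariance_add_left x_H add)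

lemma covariance_residual_right:
  assumes "j \<le> N" "l \<le> N" "k \<le> N" "f \<in> H"
  shows "covariance M f (residual j l k a p q) = covariance M f (\<lambda>\<omega>. a \<bullet> x k \<omega>)
    - (covariance M f (\<lambda>\<omega>. p \<bullet> x j \<omega>) + covariance M f (\<lambda>\<omega>. q \<bullet> x l \<omega>))"
  using covariance_residual_left[OF assms] by (simp add: covariance_commute)

lemma cov_eq_swap_ends:
  assumes le: "i \<le> N" "j \<le> N" "k \<le> N" "l \<le> N" and eq: "cov_eq (cov M x) i j k l"
  shows "cov_eq (cov M x) i l k j"
proof -
  have r: "residual l j k a q p = residual j l k a p q" for a p q
    by (auto simp: residual_def)
  show ?thesis
    using eq le by (subst cov_eq_iff; (subst (asm) cov_eq_iff)?) (auto simp: is_residual_def r, metis)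
qed

text \<open>Symmetry of conditional independence. Both residuals are orthogonal to
  \<open>x j\<close> and \<open>x l\<close>, so their mutual covariance equals the covariance of
  either residual with the original variable of the other.\<close>

lemma cov_eq_swap_points:
  assumes le: "i \<le> N" "j \<le> N" "k \<le> N" "l \<le> N" and eq: "cov_eq (cov M x) i j k l"
  shows "cov_eq (cov M x) k j i l"
  unfolding cov_eq_iff[OF le(3,2,1,4)]
proof
  fix a
  obtain p q where r: "is_residual j l i a p q" using is_residual_exists[OF le(2,4,1)] .
  have "covariance M (residual j l i a p q) (\<lambda>\<omega>. b \<bullet> x k \<omega>) = 0" for b
  proof -
    obtain p' q' where s: "is_residual j l k b p' q'" using is_residual_exists[OF le(2,4,3)] .
    let ?r = "residual j l i a p q" and ?s = "residual j l k b p' q'"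
    have "covariance M ?r (\<lambda>\<omega>. b \<bullet> x k \<omega>) = covariance M ?r ?s"
      using r le by (simp add: covariance_residual_right residual_H is_residual_def)
    also have "\<dots> = covariance M ?s ?r" by (rule covariance_commute)
    also have "\<dots> = covariance M ?s (\<lambda>\<omega>. a \<bullet> x i \<omega>)"
      using s le by (subst covariance_residual_right) (simp_all add: residual_H is_residual_def)
    also have "\<dots> = 0" by (rule cov_eqD[OF le eq s])
    finally show ?thesis .
  qed
  with r show "\<exists>p q. is_residual j l i a p q \<and>
      (\<forall>b. covariance M (residual j l i a p q) (\<lambda>\<omega>. b \<bullet> x k \<omega>) = 0)"
    by blast
qed

text \<open>The covariance of the residual of \<open>x k\<close> given \<open>(j, l)\<close> with
  the residual of \<open>x i\<close> given \<open>(j, n)\<close> is computed twice. It is zero since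
  the second residual is orthogonal to the states at \<open>j\<close>, \<open>k\<close>,
  \<open>l\<close>, and it equals the covariance of the first residual with \<open>x i\<close> since
  that residual is orthogonal to the states at \<open>j\<close> and \<open>n\<close>.\<close>

lemma cov_eq_contraction:
  assumes le: "i \<le> N" "j \<le> N" "k \<le> N" "l \<le> N" "n \<le> N"
    and k: "cov_eq (cov M x) i j k n" and l: "cov_eq (cov M x) i j l n"
    and n: "cov_eq (cov M x) n j k l"
  shows "cov_eq (cov M x) i j k l"
  unfolding cov_eq_iff[OF le(1-4)]
proof
  fix a
  obtain p q where s: "is_residual j l k a p q" using is_residual_exists[OF le(2,4,3)] .
  let ?s = "residual j l k a p q"
  have "covariance M ?s (\<lambda>\<omega>. b \<bullet> x i \<omega>) = 0" for b
  proof -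
    obtain p' q' where r: "is_residual j n i b p' q'" using is_residual_exists[OF le(2,5,1)] .
    let ?r = "residual j n i b p' q'"
    have "covariance M ?r (\<lambda>\<omega>. c \<bullet> x m \<omega>) = 0" if "m \<in> {j, k, l}" for m c
      using that r cov_eqD[OF _ _ _ _ cov_eq_swap_points[OF _ _ _ _ k] r]
        cov_eqD[OF _ _ _ _ cov_eq_swap_points[OF _ _ _ _ l] r] le
      by (auto simp: is_residual_def)
    then have "covariance M ?r ?s = 0"
      using le by (subst covariance_residual_right) (simp_all add: residual_H)
    then have "covariance M ?s ?r = 0" by (subst covariance_commute)
    moreover have "covariance M ?s ?r = covariance M ?s (\<lambda>\<omega>. b \<bullet> x i \<omega>)"
      using s le cov_eqD[OF le(5,2,3,4) n s]
      by (subst covariance_residual_right) (simp_all add: residual_H is_residual_def)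
    ultimately show ?thesis by simp
  qed
  with s show "\<exists>p q. is_residual j l k a p q \<and>
      (\<forall>b. covariance M (residual j l k a p q) (\<lambda>\<omega>. b \<bullet> x i \<omega>) = 0)"
    by blast
qed

text \<open>Joins the two directions proved for general index sets. Here \<open>j < l\<close> keeps
  the conditioning times distinct, so that the sum over \<open>{j, l}\<close> has exactly two
  terms.\<close>

lemma cond_indep_iff_cov_eq:
  assumes j: "j < l" and l: "l \<le> N" and K: "K \<subseteq> {..N}" and L: "L \<subseteq> {..N}"
  shows "cond_indep M (generated M x {j, l}) (generated M x K) (generated M x L) \<longleftrightarrow>
    (\<forall>k\<in>K. \<forall>i\<in>L. cov_eq (cov M x) i j k l)"
    (is "?indep \<longleftrightarrow> ?eq")
proof -
  have fin: "finite K" "finite L" using K L finite_subset by auto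
  have jl: "j \<le> N" "l \<le> N" using j l by auto
  have x: "x m \<in> borel_measurable M" "(\<lambda>\<omega>. b \<bullet> x m \<omega>) \<in> H" if "m \<in> {j, l} \<union> K \<union> L" for m b
    using that K L jl by (auto intro!: x_measurable x_H)
  have sum: "(\<lambda>\<omega>. a \<bullet> x k \<omega> - (\<Sum>m\<in>{j, l}. w m \<bullet> x m \<omega>)) = residual j l k a (w j) (w l)" for k a w
    using j by (simp add: residual_def)
  show ?thesis
  proof
    assume eq: ?eq
    show ?indep
    proof (rule cond_indep_if_residuals_uncorrelated[OF _ fin x])
      fix k a assume k: "k \<in> K"
      then have kN: "k \<le> N" using K by auto
      obtain p q where r: "is_residual j l k a p q" using is_residual_exists[OF jl kN] .
      define w where "w = (\<lambda>_. q)(j := p)"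
      have "covariance M (residual j l k a p q) (\<lambda>\<omega>. b \<bullet> x m \<omega>) = 0" if "m \<in> {j, l} \<union> L" for m b
        using that r cov_eqD[OF _ jl(1) kN jl(2) _ r, of m b] eq k L by (auto simp: is_residual_def)
      then show "\<exists>w. \<forall>m\<in>{j, l} \<union> L. \<forall>b. covariance M
          (\<lambda>\<omega>. a \<bullet> x k \<omega> - (\<Sum>m\<in>{j, l}. w m \<bullet> x m \<omega>)) (\<lambda>\<omega>. b \<bullet> x m \<omega>) = 0"
        unfolding sum using j by (intro exI[of _ w]) (auto simp: w_def)
    qed auto
  next
    assume indep: ?indep
    show ?eq
    proof (intro ballI)
      fix k i assume k: "k \<in> K" and i: "i \<in> L"
      then have N: "k \<le> N" "i \<le> N" using K L by auto
      show "cov_eq (cov M x) i j k l"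
        unfolding cov_eq_iff[OF N(2) jl(1) N(1) jl(2)]
      proof
        fix a
        obtain p q where r: "is_residual j l k a p q" using is_residual_exists[OF jl N(1)] .
        define w where "w = (\<lambda>_. q)(j := p)"
        have w: "residual j l k a p q = (\<lambda>\<omega>. a \<bullet> x k \<omega> - (\<Sum>m\<in>{j, l}. w m \<bullet> x m \<omega>))"
          using j unfolding sum by (simp add: w_def)
        have "covariance M (residual j l k a p q) (\<lambda>\<omega>. b \<bullet> x i \<omega>) = 0" for b
          using r by (intro covariance_residual_eq_0_if_cond_indep[OF _ x indep k i w])
            (auto simp: is_residual_def)
        with r show "\<exists>p q. is_residual j l k a p q \<and>
            (\<forall>b. covariance M (residual j l k a p q) (\<lambda>\<omega>. b \<bullet> x i \<omega>) = 0)"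
          by blast
      qed
    qed
  qed
qed

lemma reciprocal_iff_cov_eq:
  "reciprocal M N x \<longleftrightarrow> (\<forall>j l k i. j < k \<and> k < l \<and> l \<le> N \<and> (i < j \<or> l < i \<and> i \<le> N) \<longrightarrow>
    cov_eq (cov M x) i j k l)"
proof -
  have "cond_indep M (generated M x {j, l}) (generated M x {j<..<l}) (generated M x ({..<j} \<union> {l<..N}))
    \<longleftrightarrow> (\<forall>k\<in>{j<..<l}. \<forall>i\<in>{..<j} \<union> {l<..N}. cov_eq (cov M x) i j k l)" if "j < l" "l \<le> N" for j l
    using that by (intro cond_indep_iff_cov_eq) auto
  then have "reciprocal M N x \<longleftrightarrow> (\<forall>j l. j < l \<and> l \<le> N \<longrightarrow>
      (\<forall>k\<in>{j<..<l}. \<forall>i\<in>{..<j} \<union> {l<..N}. cov_eq (cov M x) i j k l))"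
    unfolding reciprocal_def by simp
  also have "\<dots> \<longleftrightarrow> (\<forall>j l k i. j < k \<and> k < l \<and> l \<le> N \<and> (i < j \<or> l < i \<and> i \<le> N) \<longrightarrow>
    cov_eq (cov M x) i j k l)"
    by (auto simp: Ball_def)
  finally show ?thesis .
qed

end

text \<open>\<open>H\<close> is the set of all linear functionals of the stacked vector, for which
  \<open>gaussian_sequence\<close> asserts normality by definition; coordinates are functionals
  given by unit vectors.\<close>

lemma gaussian_processI:
  fixes x :: "nat \<Rightarrow> 'a \<Rightarrow> real^'d"
  assumes "prob_space M" and g: "gaussian_sequence M N x"
  obtains H where "gaussian_process M H x N"
proof
  interpret prob_space M by fact
  let ?lin = "\<lambda>(a :: nat \<Rightarrow> real^'d) \<omega>. \<Sum>k\<le>N. a k \<bullet> x k \<omega>"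
  show "gaussian_process M (range ?lin) x N"
  proof unfold_locales
    show "gaussian_rv M X" if "X \<in> range ?lin" for X
      using that g by (auto simp: gaussian_sequence_def)
    show "(\<lambda>_. 0) \<in> range ?lin"
      by (rule range_eqI[of _ _ "\<lambda>_. 0"]) simp
    show "(\<lambda>\<omega>. X \<omega> + Y \<omega>) \<in> range ?lin" if XY: "X \<in> range ?lin" "Y \<in> range ?lin" for X Y
    proof -
      obtain a b where "X = ?lin a" "Y = ?lin b" using XY by blast
      then show ?thesis
        by (intro range_eqI[of _ _ "\<lambda>k. a k + b k"]) (simp add: inner_add_left sum.distrib)
    qed
    show "(\<lambda>\<omega>. r * X \<omega>) \<in> range ?lin" if X: "X \<in> range ?lin" for X r
    proof -
      obtain a where "X = ?lin a" using X by blast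
      then show ?thesis
        by (intro range_eqI[of _ _ "\<lambda>k. r *\<^sub>R a k"]) (simp add: sum_distrib_left)
    qed
    show "x k \<in> borel_measurable M" if "k \<le> N" for k
      using that g by (simp add: gaussian_sequence_def)
    show "(\<lambda>\<omega>. x k \<omega> $ c) \<in> range ?lin" if k: "k \<le> N" for k c
    proof (rule range_eqI[of _ _ "\<lambda>m. if m = k then axis c 1 else 0"])
      have "(\<Sum>m\<le>N. (if m = k then axis c 1 else 0) \<bullet> x m \<omega>)
          = (\<Sum>m\<le>N. if m = k then x m \<omega> $ c else 0)" for \<omega>
        by (intro sum.cong) (auto simp: inner_axis')
      then show "(\<lambda>\<omega>. x k \<omega> $ c) = ?lin (\<lambda>m. if m = k then axis c 1 else 0)"
        using k by simp
    qed
  qed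
qed



theorem theorem4p2:
  fixes M :: "'a measure" and N :: nat and x :: "nat \<Rightarrow> 'a \<Rightarrow> real^'d"
  assumes "prob_space M"
    and "gaussian_sequence M N x"
  shows "(reciprocal M N x \<longleftrightarrow>
            (\<forall>i\<in>{0..N}. \<forall>j\<in>{0..N}. \<forall>k\<in>{0..N}. \<forall>l\<in>{0..N}.
               l < i \<and> i < j \<and> j < k \<longrightarrow> cov_eq (cov M x) i j k l) \<and>
            (\<forall>i\<in>{0..<N}. \<forall>j\<in>{0..<N}. \<forall>k\<in>{0..<N}. \<forall>l.
               i < j \<and> j < k \<and> k < l \<and> l = N \<longrightarrow> cov_eq (cov M x) i j k l)) \<and>
         (reciprocal M N x \<longleftrightarrow>
            (\<forall>i\<in>{0..N}. \<forall>j\<in>{0..N}. \<forall>k\<in>{0..N}. \<forall>l\<in>{0..N}.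
               i < j \<and> j < k \<and> k < l \<longrightarrow> cov_eq (cov M x) i j k l) \<and>
            (\<forall>i\<in>{1..N}. \<forall>j\<in>{1..N}. \<forall>k\<in>{1..N}. \<forall>l.
               0 = l \<and> l < i \<and> i < j \<and> j < k \<longrightarrow> cov_eq (cov M x) i j k l))"
proof -
  obtain H where H: "gaussian_process M H x N" by (rule gaussian_processI[OF assms])
  interpret gaussian_process M H x N by (rule H)
  let ?C = "cov_eq (cov M x)"
  \<comment> \<open>Exchanging both the two points and the two ends converts an equation whose inner
    point is \<open>i\<close> into one whose inner point is \<open>k\<close>.\<close>
  have swap: "?C i j k l" if "?C k l i j" "i \<le> N" "j \<le> N" "k \<le> N" "l \<le> N" for i j k l
    using that by - (rule cov_eq_swap_ends[OF _ _ _ _ cov_eq_swap_points], auto)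
  have 1: "reciprocal M N x \<longleftrightarrow>
    (\<forall>i j k l. l < i \<and> i < j \<and> j < k \<and> k \<le> N \<longrightarrow> ?C i j k l) \<and>
    (\<forall>i j k. i < j \<and> j < k \<and> k < N \<longrightarrow> ?C i j k N)" (is "_ \<longleftrightarrow> ?a \<and> ?b")
  proof
    assume r: "reciprocal M N x"
    have "?C i j k l" if "l < i" "i < j" "j < k" "k \<le> N" for i j k l
      using that r unfolding reciprocal_iff_cov_eq by - (rule swap, auto)
    moreover have "?C i j k N" if "i < j" "j < k" "k < N" for i j k
      using that r unfolding reciprocal_iff_cov_eq by auto
    ultimately show "?a \<and> ?b" by blast
  next
    assume ab: "?a \<and> ?b"
    \<comment> \<open>Up to \<open>swap\<close>, condition (a) covers all points to the right of the
      conditioning interval.\<close>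
    have right: "?C i j k l" if "j < k" "k < l" "l < i" "i \<le> N" for i j k l
      using that ab by - (rule swap, auto)
    \<comment> \<open>For a point to the left, \<open>l = N\<close> is condition (b). Otherwise
      contraction with \<open>n = N\<close> applies: (b) separates \<open>i\<close> from
      \<open>k\<close> and from \<open>l\<close> given \<open>(j, N)\<close>, and
      \<open>right\<close> separates \<open>N\<close> from \<open>k\<close> given
      \<open>(j, l)\<close>.\<close>
    have left: "?C i j k l" if "i < j" "j < k" "k < l" "l \<le> N" for i j k l
    proof (cases "l = N")
      case False
      then show ?thesis
        using that ab right[of j k l N] by - (rule cov_eq_contraction[of i j k l N], auto)
    qed (use that ab in auto)
    show "reciprocal M N x"
      unfolding reciprocal_iff_cov_eq using left right by auto
  qed
  have 2: "reciprocal M N x \<longleftrightarrow>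
    (\<forall>i j k l. i < j \<and> j < k \<and> k < l \<and> l \<le> N \<longrightarrow> ?C i j k l) \<and>
    (\<forall>i j k. 0 < i \<and> i < j \<and> j < k \<and> k \<le> N \<longrightarrow> ?C i j k 0)" (is "_ \<longleftrightarrow> ?a \<and> ?b")
  proof
    assume r: "reciprocal M N x"
    have "?C i j k l" if "i < j" "j < k" "k < l" "l \<le> N" for i j k l
      using that r unfolding reciprocal_iff_cov_eq by auto
    moreover have "?C i j k 0" if "0 < i" "i < j" "j < k" "k \<le> N" for i j k
      using that r unfolding reciprocal_iff_cov_eq by - (rule swap, auto)
    ultimately show "?a \<and> ?b" by blast
  next
    assume ab: "?a \<and> ?b"
    have left: "?C i j k l" if "i < j" "j < k" "k < l" "l \<le> N" for i j k l
      using that ab by auto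
    have right: "?C i j k l" if "j < k" "k < l" "l < i" "i \<le> N" for i j k l
    \<comment> \<open>Mirror image of the argument above: the left end \<open>j\<close> plays the
      part of \<open>l\<close>, and time 0 that of \<open>N\<close>.\<close>
    proof (cases "j = 0")
      case True
      then show ?thesis using that ab by - (rule swap, auto)
    next
      case False
      \<comment> \<open>Contraction keeps its first conditioning time fixed and replaces the second
        one, so the ends are exchanged to put \<open>j\<close> in second place.\<close>
      have "?C i l k j"
      proof (rule cov_eq_contraction[of i l k j 0])
        show "?C i l k 0" "?C i l j 0"
          using that ab False by - (rule cov_eq_swap_points, auto)+
        show "?C 0 l k j"
          using that left[of 0 j k l] False by - (rule cov_eq_swap_ends, auto)
      qed (use that in auto)
      then show ?thesis using that by - (rule cov_eq_swap_ends, auto)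
    qed
    show "reciprocal M N x"
      unfolding reciprocal_iff_cov_eq using left right by auto
  qed
  \<comment> \<open>The bounded quantifiers of the statement are reduced to chains of inequalities,
    which already imply the remaining range conditions.\<close>
  have a1: "(\<forall>i\<in>{0..N}. \<forall>j\<in>{0..N}. \<forall>k\<in>{0..N}. \<forall>l\<in>{0..N}. l < i \<and> i < j \<and> j < k \<longrightarrow> ?C i j k l) \<longleftrightarrow>
      (\<forall>i j k l. l < i \<and> i < j \<and> j < k \<and> k \<le> N \<longrightarrow> ?C i j k l)" (is "?l \<longleftrightarrow> ?r")
  proof
    assume h: ?l
    show ?r by (intro allI impI h[rule_format]) auto
  qed auto
  have b1: "(\<forall>i\<in>{0..<N}. \<forall>j\<in>{0..<N}. \<forall>k\<in>{0..<N}. \<forall>l. i < j \<and> j < k \<and> k < l \<and> l = N \<longrightarrow> ?C i j k l) \<longleftrightarrow>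
      (\<forall>i j k. i < j \<and> j < k \<and> k < N \<longrightarrow> ?C i j k N)" (is "?l \<longleftrightarrow> ?r")
  proof
    assume h: ?l
    show ?r by (intro allI impI h[rule_format]) auto
  qed auto
  have a2: "(\<forall>i\<in>{0..N}. \<forall>j\<in>{0..N}. \<forall>k\<in>{0..N}. \<forall>l\<in>{0..N}. i < j \<and> j < k \<and> k < l \<longrightarrow> ?C i j k l) \<longleftrightarrow>
      (\<forall>i j k l. i < j \<and> j < k \<and> k < l \<and> l \<le> N \<longrightarrow> ?C i j k l)" (is "?l \<longleftrightarrow> ?r")
  proof
    assume h: ?l
    show ?r by (intro allI impI h[rule_format]) auto
  qed auto
  have b2: "(\<forall>i\<in>{1..N}. \<forall>j\<in>{1..N}. \<forall>k\<in>{1..N}. \<forall>l. 0 = l \<and> l < i \<and> i < j \<and> j < k \<longrightarrow> ?C i j k l) \<longleftrightarrow>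
      (\<forall>i j k. 0 < i \<and> i < j \<and> j < k \<and> k \<le> N \<longrightarrow> ?C i j k 0)" (is "?l \<longleftrightarrow> ?r")
  proof
    assume h: ?l
    show ?r by (intro allI impI h[rule_format]) auto
  qed auto
  show ?thesis
    unfolding a1 b1 a2 b2 using 1 2 by blast
qed

end
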